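(* Every abelian group $A$ has an essential embedding $A\subseteq E$ in a divisible group $E$, together with a fixed family of coordinate markers $(b_\alpha)_{\alpha<\kappa}$ of $E$ contained in $A$, with the following property. Put $M=\langle b_\alpha:\alpha<\kappa\rangle$. There is one translation-invariant metric $d$ on $E$ such that $$\mathrm{im}(d)\subseteq\{0\}\cup\{1+2^{-n}: n\in\mathbb Z,\ n\ge1\},$$ and, for this same $d$, $$\mathrm{Isom}(H,d|_{H\times H})=\mathrm{Aff}_{\pm}(H)\qquad\text{for every subgroup } H \text{ with } M\le H\le E.$$ Every such restriction $d|_{H\times H}$ is bounded, uniformly discrete, and complete. In particular, the assertion holds for $H=A$ and $H=E$.
   Context: Abelian groups are written additively and have arbitrary cardinality. An embedding $A\subseteq E$ is essential if every nonzero subgroup of $E$ meets $A$ nontrivially. Coordinate markers: $E$ is presented as a direct sum $E=\bigoplus_{\alpha<\kappa}\mathsf Q_{\tau_\alpha}$ indexed by an ordinal $\kappa$, where each type $\tau_\alpha$ is $0$ or a prime, $\mathsf Q_0=\mathbb Q$ and $\mathsf Q_p=\mathbb Z[1/p]/\mathbb Z$ for $p$ prime; the marker $b_\alpha\in E$ is the element supported at the single coordinate $\alpha$ with coefficient $m_{\tau_\alpha}$ there, where $m_0=1$ and $m_p=1/p+\mathbb Z$. (For $A=0$ take $E=M=0$ and no markers.) A metric $d$ on $E$ is translation-invariant if $d(x+c,y+c)=d(x,y)$ for all $x,y,c$. An isometry is a surjective distance-preserving map; $\mathrm{Isom}(H,d)$ is the group of isometries of $(H,d)$ onto itself. For an abelian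 group $H$, $$\mathrm{Aff}_{\pm}(H)=\{x\mapsto c+\sigma x: c\in H,\ \sigma\in\{1,-1\}\}.$$ A metric is uniformly discrete if its nonzero distances have a positive lower bound. Work in ZFC. *)

theory Defs
  imports
    "HOL-Algebra.Product_Groups"
    "HOL-Computational_Algebra.Primes"
    "HOL-Analysis.Abstract_Metric_Spaces"
begin

text \<open>
  Abelian groups are the commutative groups of HOL-Algebra, so the additive operations
  \<open>x + y\<close>, \<open>- x\<close>, \<open>n x\<close>, \<open>0\<close> appear as \<open>x \<otimes> y\<close>, \<open>inv x\<close>, \<open>x [^] n\<close>, \<open>\<one>\<close>.
\<close>

definition divisible_group :: "('a, 'b) monoid_scheme \<Rightarrow> bool" where
  "divisible_group G \<longleftrightarrow>
     comm_group G \<and> (\<forall>n::nat. n > 0 \<longrightarrow> (\<forall>x \<in> carrier G. \<exists>y \<in> carrier G. y [^]\<^bsub>G\<^esub> n = x))"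

definition essential_in :: "'a set \<Rightarrow> ('a, 'b) monoid_scheme \<Rightarrow> bool" where
  "essential_in A E \<longleftrightarrow> (\<forall>K. subgroup K E \<and> K \<noteq> {\<one>\<^bsub>E\<^esub>} \<longrightarrow> K \<inter> A \<noteq> {\<one>\<^bsub>E\<^esub>})"

definition rat_group :: "rat monoid" where
  "rat_group = \<lparr>carrier = UNIV, monoid.mult = (+), one = 0\<rparr>"

definition int_inverse :: "nat \<Rightarrow> rat set"  \<comment> \<open>\<open>\<int>[1/p]\<close>\<close> where
  "int_inverse p = {of_int a / of_nat p ^ k | a k. True}"

text \<open>
  The group \<open>Q\<^sub>t\<close>. So that all of them have the same HOL type, \<open>Q\<^sub>0 = \<rat>\<close> is taken in the
  form \<open>\<rat> / {0}\<close>, a rational \<open>q\<close> being the coset \<open>{q}\<close>.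
\<close>

definition coord_group :: "nat \<Rightarrow> rat set monoid" where
  "coord_group t =
     (if t = 0 then rat_group Mod {0} else (rat_group\<lparr>carrier := int_inverse t\<rparr>) Mod \<int>)"

definition coord_unit :: "nat \<Rightarrow> rat set" where
  "coord_unit t =
     (if t = 0 then {0} #>\<^bsub>rat_group\<^esub> 1 else \<int> #>\<^bsub>rat_group\<^esub> (1 / of_nat t))"

text \<open>
  An ordinal index is rendered by a well-order \<open>\<kappa>\<close> on a set, the indices \<open>\<alpha> < \<kappa>\<close> being the
  elements of \<^term>\<open>Field \<kappa>\<close>.
\<close>

definition coord_sum :: "'i rel \<Rightarrow> ('i \<Rightarrow> nat) \<Rightarrow> ('i \<Rightarrow> rat set) monoid" where
  "coord_sum \<kappa> \<tau> = sum_group (Field \<kappa>) (\<lambda>\<alpha>. coord_group (\<tau> \<alpha>))"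

definition coord_marker :: "'i rel \<Rightarrow> ('i \<Rightarrow> nat) \<Rightarrow> 'i \<Rightarrow> 'i \<Rightarrow> rat set" where
  "coord_marker \<kappa> \<tau> \<alpha> =
     (\<lambda>\<beta> \<in> Field \<kappa>. if \<beta> = \<alpha> then coord_unit (\<tau> \<alpha>) else \<one>\<^bsub>coord_group (\<tau> \<beta>)\<^esub>)"

definition translation_invariant ::
    "('a, 'b) monoid_scheme \<Rightarrow> ('a \<Rightarrow> 'a \<Rightarrow> real) \<Rightarrow> bool" where
  "translation_invariant G d \<longleftrightarrow>
     (\<forall>x \<in> carrier G. \<forall>y \<in> carrier G. \<forall>c \<in> carrier G. d (x \<otimes>\<^bsub>G\<^esub> c) (y \<otimes>\<^bsub>G\<^esub> c) = d x y)"

text \<open>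
  Self-maps of \<open>H\<close> are represented by functions that are undefined outside \<open>H\<close>, so that
  equality of sets of such maps means equality of maps on \<open>H\<close>.
\<close>

definition isometries :: "'a set \<Rightarrow> ('a \<Rightarrow> 'a \<Rightarrow> real) \<Rightarrow> ('a \<Rightarrow> 'a) set" where
  "isometries H d =
     {f \<in> extensional H. f ` H = H \<and> (\<forall>x \<in> H. \<forall>y \<in> H. d (f x) (f y) = d x y)}"

definition affine_pm :: "('a, 'b) monoid_scheme \<Rightarrow> 'a set \<Rightarrow> ('a \<Rightarrow> 'a) set" where
  "affine_pm G H =
     {(\<lambda>x \<in> H. c \<otimes>\<^bsub>G\<^esub> x [^]\<^bsub>G\<^esub> \<sigma>) | c \<sigma>. c \<in> H \<and> \<sigma> \<in> {1, -1 :: int}}"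

definition uniformly_discrete_on :: "'a set \<Rightarrow> ('a \<Rightarrow> 'a \<Rightarrow> real) \<Rightarrow> bool" where
  "uniformly_discrete_on H d \<longleftrightarrow> (\<exists>\<epsilon>>0. \<forall>x \<in> H. \<forall>y \<in> H. d x y \<noteq> 0 \<longrightarrow> \<epsilon> \<le> d x y)"

definition affinely_rigid ::
    "('a, 'b) monoid_scheme \<Rightarrow> ('a \<Rightarrow> 'a \<Rightarrow> real) \<Rightarrow> 'a set \<Rightarrow> bool" where
  "affinely_rigid G d H \<longleftrightarrow>
     isometries H d = affine_pm G H \<and>
     Metric_space.mbounded H d H \<and> uniformly_discrete_on H d \<and> Metric_space.mcomplete H d"

lemma comm_group_rat_group: "comm_group rat_group"
proof (rule comm_groupI)
  show "\<exists>y\<in>carrier rat_group. y \<otimes>\<^bsub>rat_group\<^esub> x = \<one>\<^bsub>rat_group\<^esub>" for x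
    by (rule bexI[of _ "- x"]) (simp_all add: rat_group_def)
qed (simp_all add: rat_group_def)

lemma rat_group_iso_coord_group_0: "(\<lambda>q. {q}) \<in> iso rat_group (coord_group 0)"
  by (auto simp: iso_def hom_def coord_group_def carrier_FactGroup rat_group_def
      r_coset_def set_mult_def bij_betw_def inj_on_def)

end

(*
  Choose in A a maximal independent family B of elements whose orders are 0 or prime, and let E be
  the sum of the corresponding coordinate groups. The map sending each element of B to its marker
  extends to A because E is divisible, and the extension is injective because B spans an essential
  subgroup.

  For the metric put d(x,y) = 1 + 2^(-n) with n depending only on a colour of x - y, invariant under
  sign; any such d is a metric because its nonzero values lie between 1 and 2. Countably many colours
  suffice, although E may be uncountable: the colour of x records the size of its support, the element
  x up to sign among the countably many elements with the same support, whether x is plus or minus a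
  marker, and a value g(supp x), where g colours singletons and pairs of indices so that no nontrivial
  permutation of the indices preserves it.

  A colour-preserving bijection f of H with f(0) = 0 permutes the axes of the markers, hence fixes each
  of them by rigidity of g. Comparing x with the markers then gives supp f(x) = supp x, so f(x) = x or
  f(x) = -x. The sign is the same for all x: if 2b is nonzero for some marker b, compare x with b;
  otherwise the sign is constant on cosets of M, and if it were + at x and - at y, then x + y + b and
  x - y + b would have the same colour for all markers b, hence x + y and x - y the same support.
*)

theory Submission
  imports Defs "HOL-Algebra.Multiplicative_Group"
begin

text \<open>A translation-invariant metric with countably many distances is a countable colouring of
  differences, whatever the size of \<open>E\<close>. A colour therefore cannot name the axes in a
  support. Names are replaced by a colouring of axes and pairs of axes without symmetries, and such
  a colouring exists on every set because a well-order has no automorphism but the identity.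

  An isometry of \<open>H\<close> is given on \<open>H\<close> only, and markers are the only points
  known to lie in every \<open>H\<close>. So all comparisons use points built from the given
  elements and markers; this is why one metric serves every \<open>H\<close>.

  The obstacle at the end is the sign. If every marker has order 2, inversion fixes all of them, and
  comparison with a single marker says nothing about the sign of f; the markers then have to be used
  as translations.

  The types are 0 or a prime because these are the orders that markers have, and every nonzero
  element of \<open>A\<close> has a multiple of such an order.\<close>

section \<open>Rigid colourings of pairs\<close>

text \<open>A well-order has a trivial automorphism group, but \<open>g\<close> sees only unordered
  pairs. Doubling the set restores the direction: an edge joins a point of one copy to a point of
  the other, and the colours of singletons tell the copies apart. A finite set can simply be
  numbered by its singletons.\<close>

lemma ex_rigid_pair_colouring:
  fixes B :: "'i set"
  shows "\<exists>g :: 'i set \<Rightarrow> nat. \<forall>\<phi>. bij_betw \<phi> B B \<longrightarrow>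
    (\<forall>\<alpha>\<in>B. \<forall>\<beta>\<in>B. g {\<phi> \<alpha>, \<phi> \<beta>} = g {\<alpha>, \<beta>}) \<longrightarrow> (\<forall>\<alpha>\<in>B. \<phi> \<alpha> = \<alpha>)"
proof (cases "finite B")
  case True
  then have inj: "inj_on (to_nat_on B) B"
    by (intro inj_on_to_nat_on countable_finite)
  show ?thesis
  proof (intro exI[of _ "\<lambda>S. to_nat_on B (the_elem S)"] allI impI ballI)
    fix \<phi> \<alpha> assume bij: "bij_betw \<phi> B B" and \<alpha>: "\<alpha> \<in> B"
      and g: "\<forall>\<alpha>\<in>B. \<forall>\<beta>\<in>B. to_nat_on B (the_elem {\<phi> \<alpha>, \<phi> \<beta>}) = to_nat_on B (the_elem {\<alpha>, \<beta>})"
    from g \<alpha> have "to_nat_on B (\<phi> \<alpha>) = to_nat_on B \<alpha>"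
      by fastforce
    with inj \<alpha> bij show "\<phi> \<alpha> = \<alpha>"
      by (meson bij_betwE inj_onD)
  qed
next
  case False
  \<comment> \<open>Split \<open>B\<close> into two copies of itself by \<open>i\<close> and \<open>s\<close>. Joining \<open>i \<alpha>\<close> to \<open>s \<beta>\<close> iff \<open>\<alpha> \<le> \<beta>\<close>
    encodes a well-order of \<open>B\<close> in an undirected graph.\<close>
  then obtain h where h: "bij_betw h (B <+> B) B"
    using card_of_Plus_infinite1[OF False card_of_mono1[OF subset_refl]]
    unfolding card_of_ordIso[symmetric] by blast
  define i s where "i = h \<circ> Inl" and "s = h \<circ> Inr"
  have inj: "inj_on h (B <+> B)" and im: "h ` (B <+> B) = B"
    using h by (auto simp: bij_betw_def)
  have i: "i \<alpha> \<in> B" and s: "s \<alpha> \<in> B" if "\<alpha> \<in> B" for \<alpha>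
    using im that by (auto simp: i_def s_def)
  have i_eq: "i \<alpha> = i \<beta> \<longleftrightarrow> \<alpha> = \<beta>" and s_eq: "s \<alpha> = s \<beta> \<longleftrightarrow> \<alpha> = \<beta>" and is_neq: "i \<alpha> \<noteq> s \<beta>"
    if "\<alpha> \<in> B" "\<beta> \<in> B" for \<alpha> \<beta>
    using that inj by (auto simp: i_def s_def inj_on_def)
  have cover: "(\<exists>\<beta>\<in>B. \<alpha> = i \<beta>) \<or> (\<exists>\<beta>\<in>B. \<alpha> = s \<beta>)" if "\<alpha> \<in> B" for \<alpha>
    using im that unfolding i_def s_def Plus_def by (auto simp: image_Un image_image)
  obtain r where r: "well_order_on B r"
    using well_order_on by blast
  then have total: "total_on B r" and refl: "refl_on B r" and "trans r" and wf: "wf (r - Id)"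
    by (simp_all add: well_order_on_def linear_order_on_def partial_order_on_def preorder_on_def)
  have lin: "(\<alpha>, \<beta>) \<in> r \<or> (\<beta>, \<alpha>) \<in> r" if "\<alpha> \<in> B" "\<beta> \<in> B" for \<alpha> \<beta>
    using total refl that unfolding total_on_def refl_on_def by (cases "\<alpha> = \<beta>") auto
  have rB: "\<alpha> \<in> B \<and> \<beta> \<in> B" if "(\<alpha>, \<beta>) \<in> r" for \<alpha> \<beta>
    using FieldI1[OF that] FieldI2[OF that] well_order_on_Field[OF r] by simp
  \<comment> \<open>Colour 0 is kept for singletons of the first copy and 1 for edges, which are
    true pairs since the copies are disjoint. Everything else, including singletons of the second
    copy, gets 2.\<close>
  define g :: "'i set \<Rightarrow> nat" where
    "g S = (if \<exists>\<alpha>\<in>B. S = {i \<alpha>} then 0 else if \<exists>\<alpha> \<beta>. (\<alpha>, \<beta>) \<in> r \<and> S = {i \<alpha>, s \<beta>} then 1 else 2)" for S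
  have g0: "g {\<alpha>, \<alpha>} = 0 \<longleftrightarrow> (\<exists>\<beta>\<in>B. \<alpha> = i \<beta>)" for \<alpha>
    by (auto simp: g_def)
  have g1: "g {i \<alpha>, s \<beta>} = 1 \<longleftrightarrow> (\<alpha>, \<beta>) \<in> r" if "\<alpha> \<in> B" "\<beta> \<in> B" for \<alpha> \<beta>
  proof -
    have "{i \<alpha>, s \<beta>} \<noteq> {i \<gamma>}" if "\<gamma> \<in> B" for \<gamma>
      using is_neq[OF that \<open>\<beta> \<in> B\<close>] by auto
    moreover have "(\<exists>\<gamma> \<delta>. (\<gamma>, \<delta>) \<in> r \<and> {i \<alpha>, s \<beta>} = {i \<gamma>, s \<delta>}) \<longleftrightarrow> (\<alpha>, \<beta>) \<in> r"
    proof
      assume "\<exists>\<gamma> \<delta>. (\<gamma>, \<delta>) \<in> r \<and> {i \<alpha>, s \<beta>} = {i \<gamma>, s \<delta>}"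
      then obtain \<gamma> \<delta> where r: "(\<gamma>, \<delta>) \<in> r" and eq: "{i \<alpha>, s \<beta>} = {i \<gamma>, s \<delta>}"
        by blast
      have "\<gamma> \<in> B" "\<delta> \<in> B"
        using rB[OF r] by auto
      then show "(\<alpha>, \<beta>) \<in> r"
        using eq r i_eq[OF that(1)] s_eq[OF that(2)] is_neq[OF that(1)]
        by (simp add: doubleton_eq_iff)
    qed blast
    ultimately show ?thesis
      by (simp add: g_def)
  qed
  show ?thesis
  proof (intro exI[of _ g] allI impI)
    fix \<phi> assume bij: "bij_betw \<phi> B B"
      and g: "\<forall>\<alpha>\<in>B. \<forall>\<beta>\<in>B. g {\<phi> \<alpha>, \<phi> \<beta>} = g {\<alpha>, \<beta>}"
    have \<phi>B: "\<phi> \<alpha> \<in> B" if "\<alpha> \<in> B" for \<alpha>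
      using bij that by (auto simp: bij_betw_def)
    have \<phi>_eq: "\<phi> \<alpha> = \<phi> \<beta> \<longleftrightarrow> \<alpha> = \<beta>" if "\<alpha> \<in> B" "\<beta> \<in> B" for \<alpha> \<beta>
      using bij that by (auto simp: bij_betw_def inj_on_def)
    \<comment> \<open>Colour 0 on singletons keeps \<open>\<phi>\<close> within each copy, so it
      splits into maps \<open>p\<close> and \<open>q\<close> of \<open>B\<close>, tied together only
      by \<open>pq\<close> below.\<close>
    have \<phi>_i: "(\<exists>\<beta>\<in>B. \<phi> \<alpha> = i \<beta>) \<longleftrightarrow> (\<exists>\<beta>\<in>B. \<alpha> = i \<beta>)" if "\<alpha> \<in> B" for \<alpha>
      using g that g0 by metis
    have "\<exists>\<beta>\<in>B. \<phi> (i \<alpha>) = i \<beta>" if "\<alpha> \<in> B" for \<alpha>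
      using \<phi>_i[OF i[OF that]] that by blast
    then obtain p where p: "\<And>\<alpha>. \<alpha> \<in> B \<Longrightarrow> p \<alpha> \<in> B \<and> \<phi> (i \<alpha>) = i (p \<alpha>)"
      by metis
    have "\<exists>\<beta>\<in>B. \<phi> (s \<alpha>) = s \<beta>" if "\<alpha> \<in> B" for \<alpha>
    proof -
      have "\<not> (\<exists>\<beta>\<in>B. \<phi> (s \<alpha>) = i \<beta>)"
        using \<phi>_i[OF s[OF that]] is_neq[OF _ that] by metis
      then show ?thesis
        using cover[OF \<phi>B[OF s[OF that]]] by blast
    qed
    then obtain q where q: "\<And>\<alpha>. \<alpha> \<in> B \<Longrightarrow> q \<alpha> \<in> B \<and> \<phi> (s \<alpha>) = s (q \<alpha>)"
      by metis
    have p_inj: "\<alpha> = \<beta>" if "p \<alpha> = p \<beta>" "\<alpha> \<in> B" "\<beta> \<in> B" for \<alpha> \<beta>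
    proof -
      have "\<phi> (i \<alpha>) = \<phi> (i \<beta>)"
        using p[of \<alpha>] p[of \<beta>] that by simp
      then show ?thesis
        using \<phi>_eq[OF i i] i_eq that by blast
    qed
    have preim: "\<exists>\<gamma>\<in>B. \<phi> \<gamma> = \<alpha>" if "\<alpha> \<in> B" for \<alpha>
      using bij_betw_imp_surj_on[OF bij] that by (metis imageE)
    have p_surj: "\<exists>\<beta>\<in>B. p \<beta> = \<alpha>" if \<alpha>: "\<alpha> \<in> B" for \<alpha>
    proof -
      obtain \<gamma> where \<gamma>: "\<gamma> \<in> B" "\<phi> \<gamma> = i \<alpha>"
        using preim[OF i[OF \<alpha>]] by blast
      then obtain \<beta> where \<beta>: "\<beta> \<in> B" "\<gamma> = i \<beta>"
        using \<phi>_i[OF \<gamma>(1)] \<alpha> by blast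
      then have "i (p \<beta>) = i \<alpha>"
        using p[OF \<beta>(1)] \<gamma>(2) by simp
      then show ?thesis
        using i_eq[of "p \<beta>" \<alpha>] p[OF \<beta>(1)] \<alpha> \<beta>(1) by blast
    qed
    have q_surj: "\<exists>\<beta>\<in>B. q \<beta> = \<alpha>" if \<alpha>: "\<alpha> \<in> B" for \<alpha>
    proof -
      obtain \<gamma> where \<gamma>: "\<gamma> \<in> B" "\<phi> \<gamma> = s \<alpha>"
        using preim[OF s[OF \<alpha>]] by blast
      then have "\<not> (\<exists>\<beta>\<in>B. \<gamma> = i \<beta>)"
        using \<phi>_i[OF \<gamma>(1)] is_neq[OF _ \<alpha>] by metis
      then obtain \<beta> where \<beta>: "\<beta> \<in> B" "\<gamma> = s \<beta>"
        using cover[OF \<gamma>(1)] by blast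
      then have "s (q \<beta>) = s \<alpha>"
        using q[OF \<beta>(1)] \<gamma>(2) by simp
      then show ?thesis
        using s_eq[of "q \<beta>" \<alpha>] q[OF \<beta>(1)] \<alpha> \<beta>(1) by blast
    qed
    have pq: "(p \<alpha>, q \<beta>) \<in> r \<longleftrightarrow> (\<alpha>, \<beta>) \<in> r" if \<alpha>: "\<alpha> \<in> B" and \<beta>: "\<beta> \<in> B" for \<alpha> \<beta>
    proof -
      have "g {i (p \<alpha>), s (q \<beta>)} = g {i \<alpha>, s \<beta>}"
        using g[rule_format, OF i[OF \<alpha>] s[OF \<beta>]] p[OF \<alpha>] q[OF \<beta>] by simp
      then show ?thesis
        using g1[OF \<alpha> \<beta>] g1[of "p \<alpha>" "q \<beta>"] p[OF \<alpha>] q[OF \<beta>] by simp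
    qed
    \<comment> \<open>A priori \<open>p\<close> and \<open>q\<close> differ, so neither is known to
      be an automorphism of \<open>r\<close>; the induction has to fix each point under both at
      once.\<close>
    have "\<alpha> \<in> B \<longrightarrow> p \<alpha> = \<alpha> \<and> q \<alpha> = \<alpha>" for \<alpha>
    proof (induction \<alpha> rule: wf_induct_rule[OF wf])
      case (1 \<beta>)
      then have IH: "p \<alpha> = \<alpha> \<and> q \<alpha> = \<alpha>" if "(\<alpha>, \<beta>) \<in> r" "\<alpha> \<noteq> \<beta>" for \<alpha>
        using that rB by blast
      show ?case
      proof
        assume \<beta>: "\<beta> \<in> B"
        have "p \<beta> = \<beta>"
        proof (rule ccontr)
          assume ne: "p \<beta> \<noteq> \<beta>"
          obtain \<delta> where \<delta>: "\<delta> \<in> B" "p \<delta> = \<beta>" using p_surj[OF \<beta>] by blast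
          \<comment> \<open>If p \<beta> < \<beta>, it would be fixed by \<open>p\<close>, against
            injectivity. Hence \<beta> < p \<beta> \<le> q \<beta>, and \<open>pq\<close> puts the
            \<open>p\<close>-preimage \<delta> of \<beta> at or below \<beta>, where induction
            applies.\<close>
          have "(p \<beta>, \<beta>) \<notin> r"
            using IH[of "p \<beta>"] p_inj[of "p \<beta>" \<beta>] p[OF \<beta>] \<beta> ne by blast
          then have "(\<beta>, p \<beta>) \<in> r" using lin p \<beta> by blast
          moreover have "(p \<beta>, q \<beta>) \<in> r" using pq[OF \<beta> \<beta>] lin \<beta> by blast
          ultimately have "(p \<delta>, q \<beta>) \<in> r" unfolding \<delta>(2) by (rule transD[OF \<open>trans r\<close>])
          then have "(\<delta>, \<beta>) \<in> r" using pq[OF \<delta>(1) \<beta>] by blast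
          then show False using IH[of \<delta>] \<delta>(2) ne by (cases "\<delta> = \<beta>") auto
        qed
        moreover have "q \<beta> = \<beta>"
        proof -
          obtain \<delta> where \<delta>: "\<delta> \<in> B" "q \<delta> = \<beta>" using q_surj[OF \<beta>] by blast
          \<comment> \<open>Here p \<delta> \<le> q \<delta> = \<beta>. If this were strict, p
            \<delta> would be fixed by both maps, forcing p \<delta> = \<delta> and then \<beta> = q
            \<delta> = p \<delta>.\<close>
          have "(p \<delta>, \<beta>) \<in> r" using pq[OF \<delta>(1) \<delta>(1)] \<delta> lin by blast
          have "p \<delta> = \<beta>"
          proof (rule ccontr)
            assume "p \<delta> \<noteq> \<beta>"
            then have "p (p \<delta>) = p \<delta>" "q (p \<delta>) = p \<delta>"
              using IH \<open>(p \<delta>, \<beta>) \<in> r\<close> by auto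
            then have "p \<delta> = \<delta>"
              using p_inj[of "p \<delta>" \<delta>] p[OF \<delta>(1)] \<delta>(1) by blast
            then show False
              using \<open>q (p \<delta>) = p \<delta>\<close> \<delta>(2) \<open>p \<delta> \<noteq> \<beta>\<close> by simp
          qed
          then have "\<delta> = \<beta>"
            using p_inj[of \<delta> \<beta>] \<open>p \<beta> = \<beta>\<close> \<delta>(1) \<beta> by simp
          then show ?thesis using \<delta>(2) by simp
        qed
        ultimately show "p \<beta> = \<beta> \<and> q \<beta> = \<beta>" ..
      qed
    qed
    then have "\<phi> (i \<alpha>) = i \<alpha>" "\<phi> (s \<alpha>) = s \<alpha>" if "\<alpha> \<in> B" for \<alpha>
      using p[OF that] q[OF that] that by simp_all
    then show "\<forall>\<alpha>\<in>B. \<phi> \<alpha> = \<alpha>"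
      using cover by blast
  qed
qed

section \<open>Colour-preserving maps of groups with markers\<close>

text \<open>The direct sum enters the rigidity argument only through supports and markers.
  \<open>countable_supp_fibre\<close> is what keeps the colours countable when the group is
  not.\<close>

locale marked_group = comm_group G for G :: "('a, 'b) monoid_scheme" (structure) +
  fixes B :: "'i set" and supp :: "'a \<Rightarrow> 'i set" and mk :: "'i \<Rightarrow> 'a" and g :: "'i set \<Rightarrow> nat"
  assumes supp_subset: "x \<in> carrier G \<Longrightarrow> supp x \<subseteq> B"
    and finite_supp: "x \<in> carrier G \<Longrightarrow> finite (supp x)"
    and supp_inv: "x \<in> carrier G \<Longrightarrow> supp (inv x) = supp x"
    and supp_mult: "x \<in> carrier G \<Longrightarrow> y \<in> carrier G \<Longrightarrow> supp (x \<otimes> y) \<subseteq> supp x \<union> supp y"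
    and countable_supp_fibre: "countable {x \<in> carrier G. supp x = S}"
    and mk_closed: "\<alpha> \<in> B \<Longrightarrow> mk \<alpha> \<in> carrier G"
    and supp_mk: "\<alpha> \<in> B \<Longrightarrow> supp (mk \<alpha>) = {\<alpha>}"
    and rigid: "bij_betw \<phi> B B \<Longrightarrow> (\<forall>\<alpha>\<in>B. \<forall>\<beta>\<in>B. g {\<phi> \<alpha>, \<phi> \<beta>} = g {\<alpha>, \<beta>}) \<Longrightarrow> \<alpha> \<in> B \<Longrightarrow> \<phi> \<alpha> = \<alpha>"
begin

lemma inv_cancel: "x \<in> carrier G \<Longrightarrow> y \<in> carrier G \<Longrightarrow> x \<otimes> (inv x \<otimes> y) = y"
  "x \<in> carrier G \<Longrightarrow> y \<in> carrier G \<Longrightarrow> inv x \<otimes> (x \<otimes> y) = y"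
  by (simp_all flip: m_assoc)

lemma left_cancel:
  "x \<in> carrier G \<Longrightarrow> y \<in> carrier G \<Longrightarrow> z \<in> carrier G \<Longrightarrow> x \<otimes> y = x \<otimes> z \<longleftrightarrow> y = z"
  by (simp add: Units_eq)

lemma mult_inv_cancel:
  "x \<in> carrier G \<Longrightarrow> y \<in> carrier G \<Longrightarrow> x \<otimes> y \<otimes> inv x = y"
  "x \<in> carrier G \<Longrightarrow> y \<in> carrier G \<Longrightarrow> z \<in> carrier G \<Longrightarrow> x \<otimes> y \<otimes> z \<otimes> inv x = y \<otimes> z"
  by (simp_all add: m_comm[of x] m_assoc)

lemma supp_mult_single:
  assumes "x \<in> carrier G" "p \<in> carrier G" "supp p \<subseteq> {\<alpha>}"
  shows "supp (x \<otimes> p) - {\<alpha>} = supp x - {\<alpha>}"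
proof -
  have "x = (x \<otimes> p) \<otimes> inv p"
    using assms by (simp add: m_assoc)
  then have "supp x \<subseteq> supp (x \<otimes> p) \<union> supp p"
    using supp_mult[of "x \<otimes> p" "inv p"] supp_inv assms by auto
  then show ?thesis
    using supp_mult[of x p] assms by auto
qed

lemma supp_mult_new:
  assumes "x \<in> carrier G" "p \<in> carrier G" "supp p = {\<alpha>}" "\<alpha> \<notin> supp x"
  shows "supp (x \<otimes> p) = insert \<alpha> (supp x)"
proof -
  have "p = (x \<otimes> p) \<otimes> inv x"
    using assms by (simp add: m_ac inv_cancel)
  then have "\<alpha> \<in> supp (x \<otimes> p)"
    using supp_mult[of "x \<otimes> p" "inv x"] supp_inv assms by auto
  then show ?thesis
    using supp_mult_single[of x p \<alpha>] assms by auto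
qed

text \<open>Adding an element of axis \<alpha> enlarges the support exactly when \<alpha> is not yet
  in it. So membership in a support is expressed by sizes of supports, which colours record.\<close>

lemma mem_supp_iff:
  assumes "x \<in> carrier G" "p \<in> carrier G" "supp p = {\<alpha>}"
  shows "\<alpha> \<in> supp x \<longleftrightarrow> card (supp (x \<otimes> p)) \<le> card (supp x)"
proof
  assume "\<alpha> \<in> supp x"
  then have "supp (x \<otimes> p) \<subseteq> supp x"
    using supp_mult[of x p] assms by auto
  then show "card (supp (x \<otimes> p)) \<le> card (supp x)"
    using finite_supp assms by (simp add: card_mono)
next
  show "\<alpha> \<in> supp x" if "card (supp (x \<otimes> p)) \<le> card (supp x)"
  proof (rule ccontr)
    assume "\<alpha> \<notin> supp x"
    with supp_mult_new[OF assms this] that finite_supp[OF assms(1)] show False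
      by simp
  qed
qed

definition marker :: "'a \<Rightarrow> bool" where
  "marker x \<longleftrightarrow> (\<exists>\<alpha>\<in>B. x = mk \<alpha> \<or> x = inv (mk \<alpha>))"

text \<open>
  Only countably many elements share a given support, so a countable set of colours can separate
  elements of equal support up to sign.
\<close>

definition fibre_code :: "'a \<Rightarrow> nat" where
  "fibre_code x = to_nat_on {y \<in> carrier G. supp y = supp x} x"

text \<open>Taking \<open>min\<close> over x and its inverse makes the colour blind to the sign,
  while on a fixed support it still determines the element up to sign.\<close>

definition colour :: "'a \<Rightarrow> nat" where
  "colour x = to_nat (min (fibre_code x) (fibre_code (inv x)), card (supp x), g (supp x), marker x)"

lemma marker_inv: "x \<in> carrier G \<Longrightarrow> marker (inv x) \<longleftrightarrow> marker x"
  unfolding marker_def using mk_closed by (metis inv_inv)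

lemma marker_supp: "marker x \<Longrightarrow> \<exists>\<alpha>\<in>B. supp x = {\<alpha>} \<and> (x = mk \<alpha> \<or> x = inv (mk \<alpha>))"
  unfolding marker_def using mk_closed supp_mk supp_inv by fastforce

lemma marker_mk: "\<alpha> \<in> B \<Longrightarrow> marker (mk \<alpha>)"
  by (auto simp: marker_def)

lemma colour_inv: "x \<in> carrier G \<Longrightarrow> colour (inv x) = colour x"
  by (simp add: colour_def supp_inv marker_inv min.commute)

lemma fibre_code_inj:
  assumes "x \<in> carrier G" "y \<in> carrier G" "supp x = supp y" "fibre_code x = fibre_code y"
  shows "x = y"
  using inj_on_to_nat_on[OF countable_supp_fibre, of "supp y"] assms
  unfolding fibre_code_def inj_on_def by simp

lemma colour_eqD:
  assumes "colour x = colour y"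
  shows "card (supp x) = card (supp y)" "g (supp x) = g (supp y)" "marker x \<longleftrightarrow> marker y"
  using assms by (simp_all add: colour_def)

text \<open>Inversion preserves the support, so all four codes number the same fibre. Each minimum
  is one of its two codes, so some code of x equals some code of y.\<close>

lemma colour_eq_supp_eq:
  assumes "colour x = colour y" "supp x = supp y" "x \<in> carrier G" "y \<in> carrier G"
  shows "x = y \<or> x = inv y"
proof -
  have "min (fibre_code x) (fibre_code (inv x)) = min (fibre_code y) (fibre_code (inv y))"
    using assms(1) by (simp add: colour_def)
  then have "fibre_code x = fibre_code y \<or> fibre_code x = fibre_code (inv y) \<or>
      fibre_code (inv x) = fibre_code y \<or> fibre_code (inv x) = fibre_code (inv y)"
    by linarith
  then show ?thesis
    using assms supp_inv fibre_code_inj by (metis inv_closed inv_inv)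
qed

text \<open>Otherwise the transposition of \<alpha> and \<beta> would preserve \<open>g\<close>: it
  fixes the pair of both and all pairs avoiding both, and the assumed equalities cover the
  rest.\<close>

lemma pair_colouring_separates:
  assumes "\<alpha> \<in> B" "\<beta> \<in> B" "\<alpha> \<noteq> \<beta>" "g {\<alpha>} = g {\<beta>}"
  shows "\<exists>\<gamma>\<in>B. \<gamma> \<noteq> \<alpha> \<and> \<gamma> \<noteq> \<beta> \<and> g {\<alpha>, \<gamma>} \<noteq> g {\<beta>, \<gamma>}"
proof (rule ccontr)
  assume "\<not> ?thesis"
  then have eq: "g {\<alpha>, \<gamma>} = g {\<beta>, \<gamma>}" if "\<gamma> \<in> B" "\<gamma> \<noteq> \<alpha>" "\<gamma> \<noteq> \<beta>" for \<gamma>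
    using that by blast
  define \<phi> where "\<phi> \<gamma> = (if \<gamma> = \<alpha> then \<beta> else if \<gamma> = \<beta> then \<alpha> else \<gamma>)" for \<gamma>
  have "bij_betw \<phi> B B"
    by (rule bij_betw_byWitness[where f' = \<phi>]) (use assms in \<open>auto simp: \<phi>_def\<close>)
  moreover have "\<forall>\<gamma>\<in>B. \<forall>\<delta>\<in>B. g {\<phi> \<gamma>, \<phi> \<delta>} = g {\<gamma>, \<delta>}"
    using eq assms by (auto simp: \<phi>_def insert_commute)
  ultimately show False
    using rigid[of \<phi> \<alpha>] assms by (simp add: \<phi>_def)
qed

end

section \<open>Colour-preserving maps of an intermediate subgroup that fix the identity\<close>

locale colour_isometry = marked_group +
  fixes H :: "'a set" and f :: "'a \<Rightarrow> 'a"
  assumes subgroup_H: "subgroup H G"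
    and mk_in_H: "\<alpha> \<in> B \<Longrightarrow> mk \<alpha> \<in> H"
    and f_image: "f ` H = H"
    and f_one: "f \<one> = \<one>"
    and f_colour: "x \<in> H \<Longrightarrow> y \<in> H \<Longrightarrow> colour (f x \<otimes> inv (f y)) = colour (x \<otimes> inv y)"
begin

lemma H_one: "\<one> \<in> H"
  and H_inv: "x \<in> H \<Longrightarrow> inv x \<in> H"
  and H_mult: "x \<in> H \<Longrightarrow> y \<in> H \<Longrightarrow> x \<otimes> y \<in> H"
  and H_carrier: "x \<in> H \<Longrightarrow> x \<in> carrier G"
  and f_closed: "x \<in> H \<Longrightarrow> f x \<in> H"
  using subgroup_H f_image by (auto simp: subgroup_def)

lemma colour_f: "x \<in> H \<Longrightarrow> colour (f x) = colour x"
  using f_colour[of x \<one>] H_one H_carrier f_closed by (simp add: f_one)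

lemma f_axis:
  assumes \<alpha>: "\<alpha> \<in> B"
  shows "f (mk \<alpha>) = mk \<alpha> \<or> f (mk \<alpha>) = inv (mk \<alpha>)"
proof -
  \<comment> \<open>\<open>f\<close> permutes the axes and preserves \<open>g\<close>, so by rigidity it fixes every axis.\<close>
  have same_axis: "card (supp (x \<otimes> inv y)) \<le> 1 \<longleftrightarrow> \<alpha> = \<beta>"
    and diff_axis: "\<alpha> \<noteq> \<beta> \<Longrightarrow> supp (x \<otimes> inv y) = {\<alpha>, \<beta>}"
    if "x \<in> carrier G" "y \<in> carrier G" "supp x = {\<alpha>}" "supp y = {\<beta>}" for x y \<alpha> \<beta>
  proof -
    show "supp (x \<otimes> inv y) = {\<alpha>, \<beta>}" if "\<alpha> \<noteq> \<beta>"
      using supp_mult_new[of x "inv y" \<beta>] that \<open>x \<in> _\<close> \<open>y \<in> _\<close> \<open>supp x = _\<close> \<open>supp y = _\<close>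
      by (auto simp: supp_inv)
    then show "card (supp (x \<otimes> inv y)) \<le> 1 \<longleftrightarrow> \<alpha> = \<beta>"
      using mem_supp_iff[of x "inv y" \<beta>] that supp_inv by (cases "\<alpha> = \<beta>") auto
  qed
  have "marker (f (mk \<alpha>))" if "\<alpha> \<in> B" for \<alpha>
    using colour_eqD(3)[OF colour_f[OF mk_in_H[OF that]]] marker_mk that by blast
  then have "\<exists>\<beta>\<in>B. supp (f (mk \<alpha>)) = {\<beta>} \<and> (f (mk \<alpha>) = mk \<beta> \<or> f (mk \<alpha>) = inv (mk \<beta>))"
    if "\<alpha> \<in> B" for \<alpha>
    using marker_supp that by blast
  then obtain \<phi> where \<phi>: "\<And>\<alpha>. \<alpha> \<in> B \<Longrightarrow> \<phi> \<alpha> \<in> B" "\<And>\<alpha>. \<alpha> \<in> B \<Longrightarrow> supp (f (mk \<alpha>)) = {\<phi> \<alpha>}"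
    "\<And>\<alpha>. \<alpha> \<in> B \<Longrightarrow> f (mk \<alpha>) = mk (\<phi> \<alpha>) \<or> f (mk \<alpha>) = inv (mk (\<phi> \<alpha>))"
    by metis
  have fmk: "f (mk \<alpha>) \<in> carrier G" if "\<alpha> \<in> B" for \<alpha>
    using that mk_in_H f_closed H_carrier by blast
  have supp_eq: "colour (f (mk \<alpha>) \<otimes> inv (f (mk \<beta>))) = colour (mk \<alpha> \<otimes> inv (mk \<beta>))"
    if "\<alpha> \<in> B" "\<beta> \<in> B" for \<alpha> \<beta>
    using f_colour mk_in_H that by blast
  \<comment> \<open>Two signed markers lie on one axis exactly when their difference has support of
    size at most 1, and this size is part of the colour.\<close>
  have eq_iff: "\<phi> \<alpha> = \<phi> \<beta> \<longleftrightarrow> \<alpha> = \<beta>" if "\<alpha> \<in> B" "\<beta> \<in> B" for \<alpha> \<beta>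
    using same_axis[OF fmk[OF that(1)] fmk[OF that(2)] \<phi>(2)[OF that(1)] \<phi>(2)[OF that(2)]]
      same_axis[OF mk_closed[OF that(1)] mk_closed[OF that(2)] supp_mk[OF that(1)] supp_mk[OF that(2)]]
      colour_eqD(1)[OF supp_eq[OF that]] by simp
  have "bij_betw \<phi> B B"
  proof (rule bij_betw_imageI)
    show "inj_on \<phi> B"
      using eq_iff by (simp add: inj_on_def)
    show "\<phi> ` B = B"
    proof
      show "\<phi> ` B \<subseteq> B" using \<phi> by blast
      show "B \<subseteq> \<phi> ` B"
      proof
        fix \<beta> assume \<beta>: "\<beta> \<in> B"
        \<comment> \<open>A preimage of \<open>mk \<beta>\<close> is a signed marker on some axis
          \<alpha>, possibly the inverse of \<open>mk \<alpha>\<close>. Comparing it with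
          \<open>mk \<alpha>\<close> shows that \<open>f\<close> sends \<open>mk \<alpha>\<close> to
          the axis \<beta>.\<close>
        obtain x where x: "x \<in> H" "f x = mk \<beta>"
          using f_image mk_in_H[OF \<beta>] by (metis imageE)
        then have "marker x"
          using colour_eqD(3)[OF colour_f[OF x(1)]] marker_mk[OF \<beta>] by simp
        then obtain \<alpha> where \<alpha>: "\<alpha> \<in> B" "supp x = {\<alpha>}"
          using marker_supp by blast
        have "card (supp (x \<otimes> inv (mk \<alpha>))) \<le> 1"
          using same_axis[OF _ _ \<alpha>(2) supp_mk[OF \<alpha>(1)]] x \<alpha> H_carrier mk_closed by blast
        then have "card (supp (mk \<beta> \<otimes> inv (f (mk \<alpha>)))) \<le> 1"
          using colour_eqD(1)[OF f_colour[OF x(1) mk_in_H[OF \<alpha>(1)]]] x by simp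
        then have "\<beta> = \<phi> \<alpha>"
          using same_axis[OF mk_closed[OF \<beta>] fmk[OF \<alpha>(1)] supp_mk[OF \<beta>] \<phi>(2)[OF \<alpha>(1)]] by blast
        then show "\<beta> \<in> \<phi> ` B" using \<alpha> by blast
      qed
    qed
  qed
  \<comment> \<open>For distinct axes, the difference of the two markers has the pair itself as
    support, so its colour exhibits \<open>g\<close> on that pair.\<close>
  moreover have "g {\<phi> \<alpha>, \<phi> \<beta>} = g {\<alpha>, \<beta>}" if "\<alpha> \<in> B" "\<beta> \<in> B" for \<alpha> \<beta>
  proof (cases "\<alpha> = \<beta>")
    case True
    then show ?thesis
      using colour_eqD(2)[OF colour_f[OF mk_in_H[OF that(1)]]] \<phi>(2) supp_mk that by simp
  next
    case False
    then show ?thesis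
      using colour_eqD(2)[OF supp_eq[OF that]] eq_iff that
        diff_axis[OF fmk[OF that(1)] fmk[OF that(2)] \<phi>(2)[OF that(1)] \<phi>(2)[OF that(2)]]
        diff_axis[OF mk_closed[OF that(1)] mk_closed[OF that(2)] supp_mk[OF that(1)] supp_mk[OF that(2)]]
      by simp
  qed
  ultimately have "\<phi> \<alpha> = \<alpha>"
    using rigid \<alpha> by blast
  then show ?thesis
    using \<phi>(3)[OF \<alpha>] by simp
qed

text \<open>By \<open>f_axis\<close> the image of \<open>mk \<alpha>\<close> still lies on the axis
  \<alpha>. So \<open>mem_supp_iff\<close> tests \<alpha> for x and for \<open>f x\<close> by sizes
  that \<open>f\<close> preserves.\<close>

lemma supp_f:
  assumes x: "x \<in> H"
  shows "supp (f x) = supp x"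
proof -
  have "\<alpha> \<in> supp (f x) \<longleftrightarrow> \<alpha> \<in> supp x" if \<alpha>: "\<alpha> \<in> B" for \<alpha>
  proof -
    note c = H_carrier[OF x] H_carrier[OF f_closed[OF x]] mk_closed[OF \<alpha>]
    have fmk: "f (mk \<alpha>) \<in> carrier G"
      by (rule H_carrier[OF f_closed[OF mk_in_H[OF \<alpha>]]])
    have supp: "supp (inv (mk \<alpha>)) = {\<alpha>}"
      by (simp only: supp_inv[OF c(3)] supp_mk[OF \<alpha>])
    have "supp (f (mk \<alpha>)) = {\<alpha>}"
      by (rule disjE[OF f_axis[OF \<alpha>]]) (simp_all only: supp supp_mk[OF \<alpha>])
    then have supp_f_mk: "supp (inv (f (mk \<alpha>))) = {\<alpha>}"
      by (simp only: supp_inv[OF fmk])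
    have "\<alpha> \<in> supp (f x) \<longleftrightarrow> card (supp (f x \<otimes> inv (f (mk \<alpha>)))) \<le> card (supp (f x))"
      by (rule mem_supp_iff[OF c(2) inv_closed[OF fmk] supp_f_mk])
    also have "\<dots> \<longleftrightarrow> card (supp (x \<otimes> inv (mk \<alpha>))) \<le> card (supp x)"
      by (simp only: colour_eqD(1)[OF f_colour[OF x mk_in_H[OF \<alpha>]]] colour_eqD(1)[OF colour_f[OF x]])
    also have "\<dots> \<longleftrightarrow> \<alpha> \<in> supp x"
      by (rule mem_supp_iff[OF c(1) inv_closed[OF c(3)] supp, symmetric])
    finally show ?thesis .
  qed
  then show ?thesis
    using supp_subset[OF H_carrier[OF x]] supp_subset[OF H_carrier[OF f_closed[OF x]]] by blast
qed

lemma f_pm: "x \<in> H \<Longrightarrow> f x = x \<or> f x = inv x"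
  by (rule colour_eq_supp_eq[OF colour_f supp_f]) (simp_all add: f_closed H_carrier)

text \<open>Let b be the marker. If f x = -x, comparing x with b gives x + b and x - b the same
  colour. Their supports agree off \<alpha> and have equal size, hence coincide. Then x + b is x - b
  or b - x, that is, 2 b = 0 or 2 x = 0, and both are excluded.\<close>

lemma fixes_all_if_fixes_marker:
  assumes \<alpha>: "\<alpha> \<in> B" and ne: "mk \<alpha> \<noteq> inv (mk \<alpha>)" and fix_mk: "f (mk \<alpha>) = mk \<alpha>" and x: "x \<in> H"
  shows "f x = x"
proof (rule ccontr)
  assume neg: "f x \<noteq> x"
  then have fx: "f x = inv x"
    using f_pm x by blast
  have c: "x \<in> carrier G" "mk \<alpha> \<in> carrier G"
    using x \<alpha> H_carrier mk_closed by blast+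
  have "colour (inv x \<otimes> inv (mk \<alpha>)) = colour (x \<otimes> inv (mk \<alpha>))"
    using f_colour[OF x mk_in_H[OF \<alpha>]] fx fix_mk by simp
  then have col: "colour (x \<otimes> mk \<alpha>) = colour (x \<otimes> inv (mk \<alpha>))"
    using colour_inv[of "x \<otimes> mk \<alpha>"] c by (simp add: inv_mult)
  have diff: "supp (x \<otimes> mk \<alpha>) - {\<alpha>} = supp (x \<otimes> inv (mk \<alpha>)) - {\<alpha>}"
    using supp_mult_single[of x "mk \<alpha>" \<alpha>] supp_mult_single[of x "inv (mk \<alpha>)" \<alpha>] c supp_mk[OF \<alpha>] supp_inv
    by simp
  have fin: "finite (supp (x \<otimes> mk \<alpha>))" "finite (supp (x \<otimes> inv (mk \<alpha>)))"
    using finite_supp c by simp_all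
  have "supp (x \<otimes> mk \<alpha>) = supp (x \<otimes> inv (mk \<alpha>))"
  proof -
    have "card (supp (x \<otimes> mk \<alpha>)) = card (supp (x \<otimes> inv (mk \<alpha>)))"
      using colour_eqD(1)[OF col] .
    then have "\<alpha> \<in> supp (x \<otimes> mk \<alpha>) \<longleftrightarrow> \<alpha> \<in> supp (x \<otimes> inv (mk \<alpha>))"
      using fin diff by (metis Diff_empty Diff_insert0 card_Diff1_less less_irrefl)
    then show ?thesis using diff by blast
  qed
  from colour_eq_supp_eq[OF col this] c
  have "x \<otimes> mk \<alpha> = x \<otimes> inv (mk \<alpha>) \<or> mk \<alpha> \<otimes> x = mk \<alpha> \<otimes> inv x"
    by (simp add: inv_mult m_comm)
  then show False
    using c ne neg fx by (metis inv_closed left_cancel)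
qed

text \<open>
  If the sign of \<open>f\<close> changed from \<open>x\<close> to \<open>x + b\<^sub>\<alpha>\<close>, then \<open>2 x + b\<^sub>\<alpha>\<close> would be some marker \<open>b\<^sub>\<beta>\<close>, and
  \<open>{\<alpha>, \<gamma>}\<close>, \<open>{\<beta>, \<gamma>}\<close> would have the same colour for every \<open>\<gamma>\<close>: the transposition of \<open>\<alpha>\<close> and \<open>\<beta>\<close>
  would preserve the rigid colouring.
\<close>

lemma fixed_coset:
  assumes inv2: "\<And>\<alpha>. \<alpha> \<in> B \<Longrightarrow> inv (mk \<alpha>) = mk \<alpha>"
    and x: "x \<in> H" "f x = x" "x \<noteq> inv x" and \<alpha>: "\<alpha> \<in> B"
  shows "f (x \<otimes> mk \<alpha>) = x \<otimes> mk \<alpha>"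
proof (rule ccontr)
  let ?y = "x \<otimes> mk \<alpha>"
  note cl = mk_closed H_carrier
  have xc: "x \<in> carrier G" and \<alpha>c: "mk \<alpha> \<in> carrier G"
    using x \<alpha> cl by auto
  have y: "?y \<in> H" using x \<alpha> mk_in_H H_mult by blast
  assume "f ?y \<noteq> ?y"
  then have fy: "f ?y = inv ?y" using f_pm y by blast
  \<comment> \<open>If \<open>f\<close> has opposite signs at z and w, then f z - f w is z + w up to
    sign; with \<open>f_colour\<close> this gives z - w and z + w the same colour.\<close>
  have col_dbl: "colour (f z \<otimes> inv (f w)) = colour (z \<otimes> w)"
    if "z \<in> H" "w \<in> H" "f z = inv z \<and> f w = w \<or> f z = z \<and> f w = inv w" for z w
    using that colour_inv[of "z \<otimes> w"] cl by (auto simp: inv_mult)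
  have "colour (?y \<otimes> x) = colour (mk \<alpha>)"
    using col_dbl[OF y x(1)] fy x f_colour[OF y x(1)] xc \<alpha>c by (simp add: mult_inv_cancel)
  then have "marker (?y \<otimes> x)"
    using colour_eqD(3) marker_mk[OF \<alpha>] by blast
  then obtain \<beta> where \<beta>: "\<beta> \<in> B" "?y \<otimes> x = mk \<beta>"
    using inv2 unfolding marker_def by auto
  \<comment> \<open>Equality would mean 2 x = 0.\<close>
  have "\<beta> \<noteq> \<alpha>"
  proof
    assume "\<beta> = \<alpha>"
    then have "mk \<alpha> \<otimes> (x \<otimes> x) = mk \<alpha> \<otimes> \<one>"
      using \<beta> xc \<alpha>c by (simp add: m_ac)
    then have "x \<otimes> x = \<one>"
      using xc \<alpha>c by (simp del: r_one)
    then show False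
      using x xc inv_equality by metis
  qed
  have \<beta>c: "mk \<beta> \<in> carrier G" using \<beta> cl by auto
  have "g {\<alpha>} = g {\<beta>}"
    using colour_eqD(2)[OF \<open>colour (?y \<otimes> x) = colour (mk \<alpha>)\<close>] \<beta> supp_mk \<alpha> by simp
  then obtain \<gamma> where \<gamma>: "\<gamma> \<in> B" "\<gamma> \<noteq> \<alpha>" "\<gamma> \<noteq> \<beta>" "g {\<alpha>, \<gamma>} \<noteq> g {\<beta>, \<gamma>}"
    using pair_colouring_separates \<alpha> \<beta> \<open>\<beta> \<noteq> \<alpha>\<close> by metis
  have \<gamma>c: "mk \<gamma> \<in> carrier G" using \<gamma> cl by auto
  let ?z = "?y \<otimes> mk \<gamma>"
  have z: "?z \<in> H" using y \<gamma> mk_in_H H_mult by blast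
  have supp2: "supp (mk \<delta> \<otimes> mk \<epsilon>) = {\<delta>, \<epsilon>}" if "\<delta> \<in> B" "\<epsilon> \<in> B" "\<delta> \<noteq> \<epsilon>" for \<delta> \<epsilon>
    using supp_mult_new[of "mk \<delta>" "mk \<epsilon>" \<epsilon>] that supp_mk cl by auto
  \<comment> \<open>If \<open>f\<close> fixed z = y + \<open>mk \<gamma>\<close>, comparison with
    the inverted y would equate the colours of z - y, a single marker, and of z + y, a sum of three
    markers on different axes.\<close>
  have "f ?z \<noteq> ?z"
  proof
    assume "f ?z = ?z"
    then have "colour (?z \<otimes> ?y) = colour (mk \<gamma>)"
      using col_dbl[OF z y] fy f_colour[OF z y] xc \<alpha>c \<gamma>c by (simp add: mult_inv_cancel)
    moreover have "?z \<otimes> ?y = (mk \<beta> \<otimes> mk \<alpha>) \<otimes> mk \<gamma>"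
      using xc \<alpha>c \<gamma>c unfolding \<beta>(2)[symmetric] by (simp add: m_ac)
    moreover have "supp ((mk \<beta> \<otimes> mk \<alpha>) \<otimes> mk \<gamma>) = {\<gamma>, \<beta>, \<alpha>}"
      using supp_mult_new[of "mk \<beta> \<otimes> mk \<alpha>" "mk \<gamma>" \<gamma>] supp2[of \<beta> \<alpha>] \<alpha> \<beta> \<gamma> \<open>\<beta> \<noteq> \<alpha>\<close> \<alpha>c \<beta>c \<gamma>c supp_mk by auto
    ultimately have "card {\<gamma>, \<beta>, \<alpha>} = card {\<gamma>}"
      using colour_eqD(1) supp_mk \<gamma> by metis
    then show False using \<gamma> \<open>\<beta> \<noteq> \<alpha>\<close> by simp
  qed
  then have "f ?z = inv ?z" using f_pm z by blast
  \<comment> \<open>Comparing the inverted z with the fixed x equates the colours of z - x and z +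
    x, whose supports are the two pairs separated by \<gamma>.\<close>
  then have "colour (?z \<otimes> x) = colour (mk \<alpha> \<otimes> mk \<gamma>)"
    using col_dbl[OF z x(1)] x f_colour[OF z x(1)] xc \<alpha>c \<gamma>c by (simp add: mult_inv_cancel)
  moreover have "?z \<otimes> x = mk \<beta> \<otimes> mk \<gamma>"
    using xc \<alpha>c \<gamma>c unfolding \<beta>(2)[symmetric] by (simp add: m_ac)
  ultimately have "g {\<beta>, \<gamma>} = g {\<alpha>, \<gamma>}"
    using colour_eqD(2)[of "?z \<otimes> x"] supp2 \<alpha> \<beta> \<gamma> by metis
  then show False using \<gamma> by simp
qed

text \<open>Reduces a map that inverts a marker to one that fixes it.\<close>

lemma inv_comp: "colour_isometry G B supp mk g H (\<lambda>x. inv (f x))"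
proof (intro colour_isometry.intro marked_group_axioms colour_isometry_axioms.intro)
  show "(\<lambda>x. inv (f x)) ` H = H"
  proof
    show "(\<lambda>x. inv (f x)) ` H \<subseteq> H"
      by (auto simp: H_inv f_closed)
    show "H \<subseteq> (\<lambda>x. inv (f x)) ` H"
    proof
      fix y assume y: "y \<in> H"
      then have "inv y \<in> f ` H"
        by (simp add: f_image H_inv)
      then obtain x where "x \<in> H" "f x = inv y"
        by auto
      then show "y \<in> (\<lambda>x. inv (f x)) ` H"
        using y H_carrier by (intro image_eqI[of _ _ x]) auto
    qed
  qed
  show "colour (inv f x \<otimes> inv (inv f y)) = colour (x \<otimes> inv y)" if "x \<in> H" "y \<in> H" for x y
    using f_colour[OF that] colour_inv[of "f x \<otimes> inv (f y)"] that f_closed H_carrier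
    by (simp add: inv_mult)
qed (use subgroup_H mk_in_H f_one in auto)

theorem f_identity_or_inverse: "(\<forall>x\<in>H. f x = x) \<or> (\<forall>x\<in>H. f x = inv x)"
proof (cases "\<exists>\<alpha>\<in>B. mk \<alpha> \<noteq> inv (mk \<alpha>)")
  case True
  then obtain \<alpha> where \<alpha>: "\<alpha> \<in> B" "mk \<alpha> \<noteq> inv (mk \<alpha>)" by blast
  interpret neg: colour_isometry G B supp mk g H "\<lambda>x. inv (f x)"
    by (rule inv_comp)
  show ?thesis
  proof (cases "f (mk \<alpha>) = mk \<alpha>")
    case True
    then show ?thesis using fixes_all_if_fixes_marker[OF \<alpha>] by simp
  next
    case False
    then have "inv (f (mk \<alpha>)) = mk \<alpha>"
      using f_axis \<alpha> mk_closed by (metis inv_inv)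
    then have neg: "inv (f x) = x" if "x \<in> H" for x
      using neg.fixes_all_if_fixes_marker[OF \<alpha>] that by simp
    have "f x = inv x" if "x \<in> H" for x
      using neg[OF that] inv_inv[OF H_carrier[OF f_closed[OF that]]] by simp
    then show ?thesis by blast
  qed
next
  case False
  then have inv2: "\<And>\<alpha>. \<alpha> \<in> B \<Longrightarrow> inv (mk \<alpha>) = mk \<alpha>" by metis
  show ?thesis
  proof (rule ccontr)
    assume "\<not> ?thesis"
    then obtain x y where xy: "x \<in> H" "f x \<noteq> inv x" "y \<in> H" "f y \<noteq> y" by blast
    then have x: "f x = x" "x \<noteq> inv x" and y: "f y = inv y" "y \<noteq> inv y"
      using f_pm by metis+
    have c: "x \<in> carrier G" "y \<in> carrier G" using xy H_carrier by auto
    let ?u = "x \<otimes> y" and ?v = "x \<otimes> inv y"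
    have uv: "colour ?u = colour ?v"
      using f_colour[OF xy(1,3)] x y c by simp
    have "\<alpha> \<in> supp ?u \<longleftrightarrow> \<alpha> \<in> supp ?v" if \<alpha>: "\<alpha> \<in> B" for \<alpha>
    proof -
      \<comment> \<open>Only x moves along its coset while y stays. Comparing the two supplies the
        second equality of sizes that \<open>mem_supp_iff\<close> needs to read both supports at
        \<alpha>.\<close>
      have "f (x \<otimes> mk \<alpha>) = x \<otimes> mk \<alpha>"
        using fixed_coset inv2 xy x \<alpha> by blast
      then have "colour (?u \<otimes> mk \<alpha>) = colour (?v \<otimes> mk \<alpha>)"
        using f_colour[of "x \<otimes> mk \<alpha>" y] xy y c \<alpha> mk_in_H H_mult mk_closed by (simp add: m_ac)
      then show ?thesis
        using mem_supp_iff[of _ "mk \<alpha>" \<alpha>] supp_mk \<alpha> mk_closed c uv colour_eqD(1)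
        by (metis inv_closed m_closed)
    qed
    then have "supp ?u = supp ?v"
      using supp_subset[of ?u] supp_subset[of ?v] c by blast
    \<comment> \<open>The alternatives amount to 2 y = 0 and 2 x = 0.\<close>
    from colour_eq_supp_eq[OF uv this] c have "x \<otimes> y = x \<otimes> inv y \<or> y \<otimes> x = y \<otimes> inv x"
      by (simp add: inv_mult m_comm)
    then show False
      using c x y by (metis inv_closed left_cancel)
  qed
qed

end

section \<open>The metric of the colouring and its isometries\<close>

context marked_group
begin

text \<open>\<open>Suc\<close> shifts colours, which start at 0, to exponents n \<ge> 1. The value 0
  outside the carrier makes nonnegativity and symmetry hold for all arguments, as
  \<open>Metric_space\<close> demands.\<close>

definition cdist :: "'a \<Rightarrow> 'a \<Rightarrow> real" where
  "cdist x y = (if x \<in> carrier G \<and> y \<in> carrier G \<and> x \<noteq> y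
     then 1 + 2 powi (- int (Suc (colour (x \<otimes> inv y)))) else 0)"

lemma cdist_eq_iff:
  assumes "x \<in> carrier G" "y \<in> carrier G" "x' \<in> carrier G" "y' \<in> carrier G"
  shows "cdist x y = cdist x' y' \<longleftrightarrow>
    (x = y \<and> x' = y') \<or> (x \<noteq> y \<and> x' \<noteq> y' \<and> colour (x \<otimes> inv y) = colour (x' \<otimes> inv y'))"
proof -
  have pos: "1 + 2 powi (- int n) \<noteq> (0::real)" for n
    by (smt (verit) zero_less_power_int)
  have inj: "(2::real) powi (- int m) = 2 powi (- int n) \<longleftrightarrow> m = n" for m n
    by (simp add: power_int_minus)
  show ?thesis
    unfolding cdist_def using assms pos pos[symmetric] inj by (auto simp del: of_nat_Suc)
qed

lemma cdist_bounds:
  shows "x \<in> carrier G \<Longrightarrow> y \<in> carrier G \<Longrightarrow> x \<noteq> y \<Longrightarrow> 1 \<le> cdist x y"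
    and "0 \<le> cdist x y" and "cdist x y \<le> 2"
proof -
  have "2 powi (- int n) \<le> (1::real)" for n
    by (simp add: power_int_minus inverse_le_1_iff)
  moreover have "0 \<le> (2::real) powi (- int n)" for n
    by simp
  ultimately show "x \<in> carrier G \<Longrightarrow> y \<in> carrier G \<Longrightarrow> x \<noteq> y \<Longrightarrow> 1 \<le> cdist x y"
    and "0 \<le> cdist x y" and "cdist x y \<le> 2"
    unfolding cdist_def by (simp_all del: of_nat_Suc add: add_nonneg_nonneg)
qed

lemma cdist_range: "cdist x y \<in> {0} \<union> {1 + 2 powi (- n) | n :: int. n \<ge> 1}"
  unfolding cdist_def by (auto simp del: of_nat_Suc intro!: exI[of _ "int (Suc (colour (x \<otimes> inv y)))"])

lemma mult_inv_diff:
  assumes "x \<in> carrier G" "y \<in> carrier G" "c \<in> carrier G"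
  shows "(x \<otimes> c) \<otimes> inv (y \<otimes> c) = x \<otimes> inv y"
proof -
  have "(x \<otimes> c) \<otimes> inv (y \<otimes> c) = c \<otimes> (x \<otimes> inv y) \<otimes> inv c"
    using assms by (simp add: inv_mult m_ac)
  then show ?thesis
    using assms by (simp add: mult_inv_cancel)
qed

lemma colour_diff_commute:
  "x \<in> carrier G \<Longrightarrow> y \<in> carrier G \<Longrightarrow> colour (y \<otimes> inv x) = colour (x \<otimes> inv y)"
  using colour_inv[of "x \<otimes> inv y"] by (simp add: inv_mult m_comm)

lemma Metric_space_cdist:
  assumes "H \<subseteq> carrier G"
  shows "Metric_space H cdist"
proof
  show "0 \<le> cdist x y" for x y
    by (rule cdist_bounds)
  show "cdist x y = cdist y x" for x y
    using colour_diff_commute[of x y] by (auto simp: cdist_def)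
  show "cdist x y = 0 \<longleftrightarrow> x = y" if "x \<in> H" "y \<in> H" for x y
  proof (cases "x = y")
    case False
    then have "1 \<le> cdist x y"
      using that assms by (intro cdist_bounds) auto
    with False show ?thesis by simp
  qed (simp add: cdist_def)
  show "cdist x z \<le> cdist x y + cdist y z" if "x \<in> H" "y \<in> H" "z \<in> H" for x y z
  proof (cases "x = y \<or> y = z")
    case True
    then show ?thesis
      by (auto simp: cdist_def)
  next
    case False
    then have "1 \<le> cdist x y" "1 \<le> cdist y z"
      using that assms by (auto intro!: cdist_bounds(1))
    then show ?thesis
      using cdist_bounds(3)[of x z] by linarith
  qed
qed

lemma translation_invariant_cdist: "translation_invariant G cdist"
  unfolding translation_invariant_def
proof (intro ballI)
  fix x y c assume c: "x \<in> carrier G" "y \<in> carrier G" "c \<in> carrier G"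
  then have "x \<otimes> c = y \<otimes> c \<longleftrightarrow> x = y"
    by simp
  with c show "cdist (x \<otimes> c) (y \<otimes> c) = cdist x y"
    by (simp add: cdist_def mult_inv_diff)
qed

lemma uniformly_discrete_cdist:
  assumes "H \<subseteq> carrier G"
  shows "uniformly_discrete_on H cdist"
  unfolding uniformly_discrete_on_def
proof (intro exI[of _ 1] conjI ballI impI)
  show "1 \<le> cdist x y" if "x \<in> H" "y \<in> H" "cdist x y \<noteq> 0" for x y
    using that assms by (intro cdist_bounds) (auto simp: cdist_def)
qed simp

lemma mbounded_cdist:
  assumes "H \<subseteq> carrier G"
  shows "Metric_space.mbounded H cdist H"
  unfolding Metric_space.mbounded_alt[OF Metric_space_cdist[OF assms]]
  by (intro conjI order_refl exI[of _ 2] ballI cdist_bounds(3))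

text \<open>Distinct points are at distance at least 1, so a Cauchy sequence is eventually
  constant.\<close>

lemma mcomplete_cdist:
  assumes H: "H \<subseteq> carrier G"
  shows "Metric_space.mcomplete H cdist"
proof -
  interpret Metric_space H cdist
    by (rule Metric_space_cdist[OF H])
  show ?thesis
    unfolding mcomplete_def
  proof (intro allI impI)
    fix s assume s: "MCauchy s"
    then have sH: "range s \<subseteq> H"
      by (simp add: MCauchy_def)
    obtain N where N: "\<And>m n. N \<le> m \<Longrightarrow> N \<le> n \<Longrightarrow> cdist (s m) (s n) < 1"
      using s unfolding MCauchy_def by (metis zero_less_one)
    have const: "s n = s N" if "N \<le> n" for n
    proof (rule ccontr)
      assume "s n \<noteq> s N"
      moreover have "s n \<in> carrier G" "s N \<in> carrier G"
        using sH H by auto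
      ultimately have "1 \<le> cdist (s n) (s N)"
        by (intro cdist_bounds(1))
      then show False
        using N[OF that order_refl] by simp
    qed
    have "limitin mtopology s (s N) sequentially"
      unfolding limitin_metric
    proof (intro conjI allI impI)
      show "s N \<in> H" using sH by auto
      show "\<forall>\<^sub>F n in sequentially. s n \<in> H \<and> cdist (s n) (s N) < \<epsilon>" if "0 < \<epsilon>" for \<epsilon>
      proof (rule eventually_sequentiallyI)
        show "s n \<in> H \<and> cdist (s n) (s N) < \<epsilon>" if "N \<le> n" for n
          using const[OF that] sH \<open>0 < \<epsilon>\<close> by (auto simp: cdist_def)
      qed
    qed
    then show "\<exists>x. limitin mtopology s x sequentially" ..
  qed
qed

text \<open>An isometry followed by translation by -f(0) is a \<open>colour_isometry\<close>.
  Conversely, translations keep differences, and inversion keeps colours.\<close>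

lemma isometries_cdist:
  assumes H: "subgroup H G" and mk: "mk ` B \<subseteq> H"
  shows "isometries H cdist = affine_pm G H"
proof
  interpret H: subgroup H G by (rule H)
  show "isometries H cdist \<subseteq> affine_pm G H"
  proof
    fix f assume "f \<in> isometries H cdist"
    then have ext: "f \<in> extensional H" and im: "f ` H = H"
      and dist: "\<And>x y. x \<in> H \<Longrightarrow> y \<in> H \<Longrightarrow> cdist (f x) (f y) = cdist x y"
      by (auto simp: isometries_def)
    have fH: "f x \<in> H" if "x \<in> H" for x
      using imageI[OF that, of f] im by simp
    define c where "c = f \<one>"
    have c: "c \<in> H"
      by (simp add: c_def fH)
    \<comment> \<open>The diagonal is separate because distance 0 carries no colour.\<close>
    have col: "colour (f x \<otimes> inv (f y)) = colour (x \<otimes> inv y)" if "x \<in> H" "y \<in> H" for x y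
      using dist[OF that] fH that by (cases "x = y") (auto simp: cdist_eq_iff)
    have cancel: "(y \<otimes> c) \<otimes> inv c = y" "(y \<otimes> inv c) \<otimes> c = y" if "y \<in> H" for y
      using that c by (simp_all add: m_assoc)
    interpret colour_isometry G B supp mk g H "\<lambda>x. f x \<otimes> inv c"
    proof (intro colour_isometry.intro marked_group_axioms colour_isometry_axioms.intro)
      show "(\<lambda>x. f x \<otimes> inv c) ` H = H"
      proof
        show "(\<lambda>x. f x \<otimes> inv c) ` H \<subseteq> H"
          using fH c by auto
        show "H \<subseteq> (\<lambda>x. f x \<otimes> inv c) ` H"
        proof
          fix y assume y: "y \<in> H"
          then have "y \<otimes> c \<in> f ` H"
            using c im by simp
          then obtain x where "x \<in> H" "f x = y \<otimes> c"
            by auto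
          then show "y \<in> (\<lambda>x. f x \<otimes> inv c) ` H"
            using cancel y by (intro image_eqI[of _ _ x]) auto
        qed
      qed
      show "colour (f x \<otimes> inv c \<otimes> inv (f y \<otimes> inv c)) = colour (x \<otimes> inv y)" if "x \<in> H" "y \<in> H" for x y
        using col[OF that] fH that c by (simp add: mult_inv_diff)
    qed (use H mk c in \<open>auto simp flip: c_def\<close>)
    have "\<exists>\<sigma> \<in> {1, -1 :: int}. \<forall>x\<in>H. f x \<otimes> inv c = x [^] \<sigma>"
      using f_identity_or_inverse by (auto simp: int_pow_neg)
    then obtain \<sigma> :: int
      where \<sigma>: "\<sigma> \<in> {1, -1}" "\<And>x. x \<in> H \<Longrightarrow> f x \<otimes> inv c = x [^] \<sigma>"
      by blast
    have "f x = c \<otimes> x [^] \<sigma>" if "x \<in> H" for x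
      using \<sigma>(2)[OF that] cancel(2)[OF fH[OF that]] that c by (simp add: m_comm)
    then have "f = (\<lambda>x\<in>H. c \<otimes> x [^] \<sigma>)"
      using ext by (auto simp: extensional_def restrict_def)
    then show "f \<in> affine_pm G H"
      using c \<sigma>(1) unfolding affine_pm_def by blast
  qed
  show "affine_pm G H \<subseteq> isometries H cdist"
  proof
    fix f assume "f \<in> affine_pm G H"
    then obtain c \<sigma> where f: "f = (\<lambda>x\<in>H. c \<otimes> x [^] \<sigma>)" and c: "c \<in> H" and \<sigma>: "\<sigma> \<in> {1, -1 :: int}"
      unfolding affine_pm_def by blast
    have pow: "x [^] \<sigma> \<in> H" "(x [^] \<sigma>) [^] \<sigma> = x" if "x \<in> H" for x
      using \<sigma> that by (auto simp: int_pow_neg)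
    have fH: "f x \<in> H" if "x \<in> H" for x
      using pow that c by (simp add: f)
    have "f ` H = H"
    proof
      show "f ` H \<subseteq> H" using fH by auto
      show "H \<subseteq> f ` H"
      proof
        fix y assume y: "y \<in> H"
        have "f ((inv c \<otimes> y) [^] \<sigma>) = y"
          using pow y c by (simp add: f inv_cancel)
        moreover have "(inv c \<otimes> y) [^] \<sigma> \<in> H"
          using y c by (intro pow) simp
        ultimately show "y \<in> f ` H"
          by (metis imageI)
      qed
    qed
    moreover have "cdist (f x) (f y) = cdist x y" if "x \<in> H" "y \<in> H" for x y
    proof -
      have xy: "x \<in> carrier G" "y \<in> carrier G" "c \<in> carrier G" "x [^] \<sigma> \<in> carrier G" "y [^] \<sigma> \<in> carrier G"
        using that c by auto
      have "f x \<otimes> inv (f y) = x [^] \<sigma> \<otimes> inv (y [^] \<sigma>)"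
        using that mult_inv_diff[of "x [^] \<sigma>" "y [^] \<sigma>" c] xy by (simp add: f m_comm)
      moreover have "colour (x [^] \<sigma> \<otimes> inv (y [^] \<sigma>)) = colour (x \<otimes> inv y)"
        using \<sigma> xy colour_diff_commute[of x y] by (auto simp: int_pow_neg m_comm[of "inv x" y])
      moreover have "f x = f y \<longleftrightarrow> x = y"
      proof -
        have "f x = f y \<longleftrightarrow> x [^] \<sigma> = y [^] \<sigma>"
          using that xy by (simp add: f left_cancel)
        then show ?thesis using pow that by metis
      qed
      ultimately show ?thesis
        using that fH by (simp add: cdist_eq_iff)
    qed
    ultimately show "f \<in> isometries H cdist"
      by (auto simp: isometries_def f)
  qed
qed

theorem affinely_rigid_cdist:
  assumes "subgroup H G" and "mk ` B \<subseteq> H"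
  shows "affinely_rigid G cdist H"
  unfolding affinely_rigid_def
  by (intro conjI isometries_cdist mbounded_cdist uniformly_discrete_cdist mcomplete_cdist
      subgroup.subset assms)

end

section \<open>The coordinate groups and their direct sum\<close>

text \<open>Numerator and denominator of the quotient Q_t, so that the rational and the quasicyclic
  case share one description.\<close>

definition coord_num :: "nat \<Rightarrow> rat monoid" where
  "coord_num t = rat_group\<lparr>carrier := if t = 0 then UNIV else int_inverse t\<rparr>"

definition coord_den :: "nat \<Rightarrow> rat set" where
  "coord_den t = (if t = 0 then {0} else \<int>)"

definition coord_class :: "nat \<Rightarrow> rat \<Rightarrow> rat set" where
  "coord_class t q = coord_den t #>\<^bsub>coord_num t\<^esub> q"

lemma mult_coord_num [simp]: "x \<otimes>\<^bsub>coord_num t\<^esub> y = x + y"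
  and one_coord_num [simp]: "\<one>\<^bsub>coord_num t\<^esub> = 0"
  by (simp_all add: coord_num_def rat_group_def)

lemma coord_group_eq: "coord_group t = coord_num t Mod coord_den t"
  by (simp add: coord_group_def coord_num_def coord_den_def rat_group_def)

lemma coord_unit_eq: "coord_unit t = coord_class t (if t = 0 then 1 else 1 / of_nat t)"
  by (simp add: coord_unit_def coord_class_def coord_num_def coord_den_def rat_group_def r_coset_def)

lemma int_inverse_iff:
  assumes "t \<noteq> 0"
  shows "q \<in> int_inverse t \<longleftrightarrow> (\<exists>k. of_nat t ^ k * q \<in> \<int>)"
proof
  assume "q \<in> int_inverse t"
  then obtain a k where "q = of_int a / of_nat t ^ k"
    by (auto simp: int_inverse_def)
  then have "of_nat t ^ k * q = of_int a"
    using assms by simp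
  then show "\<exists>k. of_nat t ^ k * q \<in> \<int>"
    by (metis Ints_of_int)
next
  assume "\<exists>k. of_nat t ^ k * q \<in> \<int>"
  then obtain k a where "of_nat t ^ k * q = of_int a"
    by (auto elim: Ints_cases)
  then have "q = of_int a / of_nat t ^ k"
    using assms by (simp add: field_simps)
  then show "q \<in> int_inverse t"
    by (auto simp: int_inverse_def)
qed

lemma comm_group_coord_num: "comm_group (coord_num t)"
proof (cases "t = 0")
  case True
  then have "coord_num t = rat_group"
    by (simp add: coord_num_def rat_group_def)
  then show ?thesis
    using comm_group_rat_group by simp
next
  case False
  have mult: "of_nat t ^ j * (q :: rat) \<in> \<int>" if "of_nat t ^ k * q \<in> \<int>" "k \<le> j" for j k q
  proof -
    have "(of_nat t :: rat) ^ j = of_nat t ^ (j - k) * of_nat t ^ k"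
      using that(2) by (simp flip: power_add)
    then have "(of_nat t :: rat) ^ j * q = of_nat t ^ (j - k) * (of_nat t ^ k * q)"
      by (simp only: mult.assoc)
    then show ?thesis
      using that(1) by (metis Ints_mult Ints_of_nat of_nat_power)
  qed
  have add: "x + y \<in> int_inverse t" if xy: "x \<in> int_inverse t" "y \<in> int_inverse t" for x y
  proof -
    obtain k j where "of_nat t ^ k * x \<in> \<int>" "of_nat t ^ j * y \<in> \<int>"
      using xy False by (auto simp: int_inverse_iff)
    then have "of_nat t ^ max k j * x \<in> \<int>" "of_nat t ^ max k j * y \<in> \<int>"
      using mult by auto
    then have "of_nat t ^ max k j * (x + y) \<in> \<int>"
      by (simp add: distrib_left)
    then show ?thesis
      using False by (auto simp: int_inverse_iff)
  qed
  have minus: "- x \<in> int_inverse t" if "x \<in> int_inverse t" for x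
    using that False by (auto simp: int_inverse_iff)
  have zero: "0 \<in> int_inverse t"
    using False by (auto simp: int_inverse_iff)
  have carrier: "carrier (coord_num t) = int_inverse t"
    using False by (simp add: coord_num_def)
  show ?thesis
    by (rule comm_groupI) (auto simp: carrier add zero minus intro!: bexI[of _ "- x" for x])
qed

lemma inv_coord_num: "x \<in> carrier (coord_num t) \<Longrightarrow> inv\<^bsub>coord_num t\<^esub> x = - x"
proof -
  interpret comm_group "coord_num t"
    by (rule comm_group_coord_num)
  show "x \<in> carrier (coord_num t) \<Longrightarrow> inv\<^bsub>coord_num t\<^esub> x = - x"
    using r_inv[of x] by (simp add: eq_neg_iff_add_eq_0 add.commute)
qed

lemma int_pow_coord_num:
  assumes "x \<in> carrier (coord_num t)"
  shows "x [^]\<^bsub>coord_num t\<^esub> (n::int) = of_int n * x"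
proof -
  interpret comm_group "coord_num t"
    by (rule comm_group_coord_num)
  have nat: "x [^]\<^bsub>coord_num t\<^esub> (n::nat) = of_nat n * x" for n
    by (induction n) (simp_all add: algebra_simps)
  have closed: "of_nat n * x \<in> carrier (coord_num t)" for n
    using nat_pow_closed[OF assms, of n] by (simp add: nat)
  show ?thesis
    by (cases n rule: int_cases2)
      (simp_all add: assms closed int_pow_int int_pow_neg_int nat inv_coord_num)
qed

lemma subgroup_coord_den: "subgroup (coord_den t) (coord_num t)"
proof (rule group.subgroupI)
  show "group (coord_num t)"
    using comm_group_coord_num comm_group.axioms by blast
  show sub: "coord_den t \<subseteq> carrier (coord_num t)"
    using int_inverse_iff[of t] by (auto simp: coord_den_def coord_num_def rat_group_def intro: exI[of _ 0])
  show "inv\<^bsub>coord_num t\<^esub> a \<in> coord_den t" if "a \<in> coord_den t" for a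
    using that sub by (subst inv_coord_num) (auto simp: coord_den_def)
qed (auto simp: coord_den_def)

lemma normal_coord_den: "coord_den t \<lhd> coord_num t"
  by (rule comm_group.normal_iff_subgroup[THEN iffD2, OF comm_group_coord_num subgroup_coord_den])

lemma comm_group_coord_group: "comm_group (coord_group t)"
  unfolding coord_group_eq
  by (rule comm_group.abelian_FactGroup[OF comm_group_coord_num subgroup_coord_den])

lemma group_coord_group: "group (coord_group t)"
  using comm_group_coord_group comm_group.axioms(2) by blast

lemma carrier_coord_group: "carrier (coord_group t) = coord_class t ` carrier (coord_num t)"
  by (simp add: coord_group_eq carrier_FactGroup coord_class_def)

lemma countable_carrier_coord_group: "countable (carrier (coord_group t))"
  by (simp add: carrier_coord_group)

lemma coord_class_pow:
  "q \<in> carrier (coord_num t) \<Longrightarrow> coord_class t q [^]\<^bsub>coord_group t\<^esub> (n::int) = coord_class t (of_int n * q)"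
  unfolding coord_class_def coord_group_eq
  by (simp add: normal.FactGroup_int_pow[OF normal_coord_den] int_pow_coord_num)

lemma coord_class_eq_iff: "coord_class t q = coord_class t r \<longleftrightarrow> q - r \<in> coord_den t"
proof -
  have *: "x \<in> coord_class t r \<longleftrightarrow> x - r \<in> coord_den t" for x r
    by (auto simp: coord_class_def r_coset_def coord_den_def intro: bexI[of _ "x - r"])
  have "q \<in> coord_class t q"
    by (simp add: * coord_den_def)
  moreover have "x \<in> coord_class t q \<longleftrightarrow> x \<in> coord_class t r" if "q - r \<in> coord_den t" for x
    using that Ints_add[of "x - q" "q - r"] Ints_diff[of "x - r" "q - r"]
    by (auto simp: * coord_den_def)
  ultimately show ?thesis
    by (auto simp: *)
qed

lemma one_coord_group: "\<one>\<^bsub>coord_group t\<^esub> = coord_class t 0"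
  by (simp add: coord_group_eq coord_class_def r_coset_def)

lemma coord_class_eq_one: "coord_class t q = \<one>\<^bsub>coord_group t\<^esub> \<longleftrightarrow> q \<in> coord_den t"
  by (simp add: one_coord_group coord_class_eq_iff)

lemma unit_in_coord_num: "(if t = 0 then 1 else 1 / of_nat t) \<in> carrier (coord_num t)"
  using int_inverse_iff[of t "1 / of_nat t"]
  by (auto simp: coord_num_def rat_group_def intro: exI[of _ 1])

lemma coord_unit_closed: "coord_unit t \<in> carrier (coord_group t)"
  unfolding coord_unit_eq carrier_coord_group using unit_in_coord_num by (rule imageI)

lemma coord_unit_pow: "coord_unit t [^]\<^bsub>coord_group t\<^esub> (n::int) =
    coord_class t (if t = 0 then of_int n else of_int n / of_nat t)"
  unfolding coord_unit_eq by (simp add: coord_class_pow[OF unit_in_coord_num])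

text \<open>The marker has order t, infinite order being covered by the fact that 0 divides only 0;
  \<open>ord\<close> follows the same convention.\<close>

lemma coord_unit_pow_eq_one:
  "coord_unit t [^]\<^bsub>coord_group t\<^esub> (n::int) = \<one>\<^bsub>coord_group t\<^esub> \<longleftrightarrow> int t dvd n"
proof (cases "t = 0")
  case True
  then show ?thesis
    by (simp add: coord_unit_pow coord_class_eq_one coord_den_def)
next
  case False
  have "of_int n / of_nat t \<in> (\<int> :: rat set) \<longleftrightarrow> int t dvd n"
  proof
    assume "of_int n / of_nat t \<in> (\<int> :: rat set)"
    then obtain a where "of_int n / of_nat t = (of_int a :: rat)"
      by (auto elim: Ints_cases)
    then have "of_int n = (of_int (int t * a) :: rat)"
      using False by (simp add: field_simps)
    then have "n = int t * a"
      by (simp only: of_int_eq_iff)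
    then show "int t dvd n" by simp
  qed (use False in auto)
  then show ?thesis
    using False by (simp add: coord_unit_pow coord_class_eq_one coord_den_def)
qed

text \<open>Multiply a representative until it just becomes a multiple of the marker: over the
  rationals by its denominator, otherwise by one power of t less than clears it. Minimality of the
  clearing power keeps the resulting a/t from being an integer.\<close>

lemma coord_group_essential:
  assumes t: "t = 0 \<or> prime t" and x: "x \<in> carrier (coord_group t)" "x \<noteq> \<one>\<^bsub>coord_group t\<^esub>"
  obtains n k :: int where "x [^]\<^bsub>coord_group t\<^esub> n \<noteq> \<one>\<^bsub>coord_group t\<^esub>"
    and "x [^]\<^bsub>coord_group t\<^esub> n = coord_unit t [^]\<^bsub>coord_group t\<^esub> k"
proof -
  obtain q where q: "q \<in> carrier (coord_num t)" "x = coord_class t q"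
    using x(1) by (auto simp: carrier_coord_group)
  with x(2) have qd: "q \<notin> coord_den t"
    by (simp add: coord_class_eq_one)
  show thesis
  proof (cases "t = 0")
    case True
    obtain a b where "q = of_int a / of_int b" "b > 0"
      by (metis quotient_of_div surj_pair quotient_of_denom_pos)
    then have "of_int b * q = of_int a" "of_int b * q \<noteq> 0"
      using qd True by (auto simp: coord_den_def)
    then show thesis
      using that[of b a] True q coord_class_eq_one[of t]
      by (simp add: coord_class_pow coord_unit_pow coord_den_def)
  next
    case False
    define k where "k = (LEAST k. of_nat t ^ k * q \<in> \<int>)"
    have "\<exists>k. of_nat t ^ k * q \<in> \<int>"
      using q(1) False int_inverse_iff[of t q] by (simp add: coord_num_def)
    then have k: "of_nat t ^ k * q \<in> \<int>"
      unfolding k_def by (rule LeastI_ex)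
    have "q \<notin> \<int>"
      using qd False by (simp add: coord_den_def)
    with k have "k \<noteq> 0"
      by (metis mult_1 power_0)
    then have pred: "of_nat t ^ (k - 1) * q \<notin> \<int>"
      unfolding k_def by (intro not_less_Least) simp
    obtain a where "of_nat t ^ k * q = of_int a"
      using k by (auto elim: Ints_cases)
    then have "of_nat t * (of_nat t ^ (k - 1) * q) = of_int a"
      using \<open>k \<noteq> 0\<close> by (simp flip: mult.assoc power_Suc)
    then have "of_nat t ^ (k - 1) * q = of_int a / of_nat t"
      using False by (simp add: field_simps)
    then show thesis
      using that[of "int t ^ (k - 1)" a] pred False q coord_class_eq_one[of t]
      by (simp add: coord_class_pow coord_unit_pow coord_den_def)
  qed
qed

text \<open>Division by powers of t is possible in Z[1/t] itself. Division by a number prime to t is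
  possible only modulo the integers, where Bezout supplies an inverse.\<close>

lemma divisible_coord_group:
  assumes t: "t = 0 \<or> prime t" and x: "x \<in> carrier (coord_group t)" and n: "n > (0::nat)"
  obtains y where "y \<in> carrier (coord_group t)" "y [^]\<^bsub>coord_group t\<^esub> n = x"
proof -
  obtain q where q: "q \<in> carrier (coord_num t)" "x = coord_class t q"
    using x by (auto simp: carrier_coord_group)
  have "\<exists>r \<in> carrier (coord_num t). of_nat n * r - q \<in> coord_den t"
  proof (cases "t = 0")
    case True
    then show ?thesis
      using n by (intro bexI[of _ "q / of_nat n"]) (simp_all add: coord_num_def coord_den_def rat_group_def)
  next
    case False
    with t have p: "prime t" by simp
    obtain m where m: "n = t ^ multiplicity t n * m" "\<not> t dvd m"
      using multiplicity_decompose'[of n t] n p not_prime_unit by (metis less_not_refl)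
    obtain k a where a: "of_nat t ^ k * q = of_int a"
      using q(1) False int_inverse_iff[of t q] by (auto simp: coord_num_def elim: Ints_cases)
    have "coprime m t"
      using prime_imp_coprime[OF p m(2)] by (simp add: coprime_commute)
    then have "coprime (int m) (int t ^ k)"
      by simp
    then obtain u v where uv: "int m * u + int t ^ k * v = 1"
      by (metis bezout_int coprime_imp_gcd_eq_1 mult.commute)
    let ?j = "multiplicity t n"
    \<comment> \<open>With q = a/t^k, n = t^j m and m u + t^k v = 1, the product n r is a m u / t^k
      = q - a v.\<close>
    define r where "r = (of_int (a * u) / of_nat t ^ (k + ?j) :: rat)"
    have "r \<in> int_inverse t"
      unfolding r_def int_inverse_def by blast
    then have "r \<in> carrier (coord_num t)"
      using False by (simp add: coord_num_def)
    moreover have "of_nat n * r - q = of_int (- (a * v))"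
    proof -
      have T: "(of_nat t :: rat) \<noteq> 0" using False by simp
      have "(of_nat n :: rat) = of_nat t ^ ?j * of_nat m"
        using arg_cong[OF m(1), of "of_nat :: nat \<Rightarrow> rat"] by simp
      then have "of_nat t ^ k * (of_nat n * r) = of_nat m * of_int (a * u)"
        using T by (simp add: r_def power_add field_simps)
      then have "of_nat t ^ k * (of_nat n * r - q) = of_int (int m * (a * u) - a)"
        using a by (simp add: right_diff_distrib)
      also have "int m * (a * u) - a = int t ^ k * (- (a * v))"
        using arg_cong[OF uv, of "\<lambda>z. a * z"] by (simp add: algebra_simps)
      also have "of_int (int t ^ k * (- (a * v))) = (of_nat t ^ k * of_int (- (a * v)) :: rat)"
        by simp
      finally show ?thesis
        using T by (metis mult_left_cancel power_not_zero)
    qed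
    ultimately show ?thesis
      using False by (intro bexI[of _ r]) (simp_all add: coord_den_def)
  qed
  then obtain r where r: "r \<in> carrier (coord_num t)" "of_nat n * r - q \<in> coord_den t"
    by blast
  show thesis
  proof
    show "coord_class t r \<in> carrier (coord_group t)"
      using r by (simp add: carrier_coord_group)
    show "coord_class t r [^]\<^bsub>coord_group t\<^esub> n = x"
      using coord_class_pow[OF r(1), of "int n"] r(2) q
      by (simp add: int_pow_int coord_class_eq_iff)
  qed
qed

section \<open>The direct sum of coordinate groups and its markers\<close>

locale coordinate_sum =
  fixes \<kappa> :: "'i rel" and \<tau> :: "'i \<Rightarrow> nat"
  assumes type: "\<alpha> \<in> Field \<kappa> \<Longrightarrow> \<tau> \<alpha> = 0 \<or> prime (\<tau> \<alpha>)"
begin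

abbreviation "B \<equiv> Field \<kappa>"
abbreviation "E \<equiv> coord_sum \<kappa> \<tau>"
abbreviation "Q \<alpha> \<equiv> coord_group (\<tau> \<alpha>)"
abbreviation "b \<equiv> coord_marker \<kappa> \<tau>"

definition supp :: "('i \<Rightarrow> rat set) \<Rightarrow> 'i set" where
  "supp x = {\<alpha> \<in> B. x \<alpha> \<noteq> \<one>\<^bsub>Q \<alpha>\<^esub>}"

lemma Q_group: "group (Q \<alpha>)"
  by (rule group_coord_group)

lemma carrier_E: "carrier E = {x \<in> \<Pi>\<^sub>E \<alpha>\<in>B. carrier (Q \<alpha>). finite (supp x)}"
  unfolding coord_sum_def supp_def by (rule carrier_sum_group) (rule Q_group)

lemma one_E: "\<one>\<^bsub>E\<^esub> = (\<lambda>\<alpha>\<in>B. \<one>\<^bsub>Q \<alpha>\<^esub>)"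
  and mult_E: "x \<otimes>\<^bsub>E\<^esub> y = (\<lambda>\<alpha>\<in>B. x \<alpha> \<otimes>\<^bsub>Q \<alpha>\<^esub> y \<alpha>)"
  by (simp_all add: coord_sum_def)

lemma comm_group_E: "comm_group E"
proof (rule group.group_comm_groupI)
  show "group E"
    unfolding coord_sum_def by (rule sum_group) (rule Q_group)
  show "x \<otimes>\<^bsub>E\<^esub> y = y \<otimes>\<^bsub>E\<^esub> x" if "x \<in> carrier E" "y \<in> carrier E" for x y
    unfolding mult_E
  proof (rule restrict_ext)
    fix \<alpha> assume "\<alpha> \<in> B"
    then have "x \<alpha> \<in> carrier (Q \<alpha>)" "y \<alpha> \<in> carrier (Q \<alpha>)"
      using that by (auto simp: carrier_E)
    then show "x \<alpha> \<otimes>\<^bsub>Q \<alpha>\<^esub> y \<alpha> = y \<alpha> \<otimes>\<^bsub>Q \<alpha>\<^esub> x \<alpha>"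
      using comm_groupE(4)[OF comm_group_coord_group] by blast
  qed
qed

sublocale E: comm_group E
  by (rule comm_group_E)

lemma coord_closed: "x \<in> carrier E \<Longrightarrow> \<alpha> \<in> B \<Longrightarrow> x \<alpha> \<in> carrier (Q \<alpha>)"
  by (auto simp: carrier_E)

lemma coord_hom: "\<alpha> \<in> B \<Longrightarrow> group_hom E (Q \<alpha>) (\<lambda>x. x \<alpha>)"
  by (intro group_hom.intro group_hom_axioms.intro homI E.is_group Q_group)
    (simp_all add: coord_closed mult_E)

lemma E_eqI: "x \<in> carrier E \<Longrightarrow> y \<in> carrier E \<Longrightarrow> (\<And>\<alpha>. \<alpha> \<in> B \<Longrightarrow> x \<alpha> = y \<alpha>) \<Longrightarrow> x = y"
  unfolding carrier_E by (rule PiE_ext[of x B "\<lambda>\<alpha>. carrier (Q \<alpha>)"]) auto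

lemma coord_one: "\<alpha> \<in> B \<Longrightarrow> \<one>\<^bsub>E\<^esub> \<alpha> = \<one>\<^bsub>Q \<alpha>\<^esub>"
  by (simp add: one_E)

lemma coord_mult: "\<alpha> \<in> B \<Longrightarrow> (x \<otimes>\<^bsub>E\<^esub> y) \<alpha> = x \<alpha> \<otimes>\<^bsub>Q \<alpha>\<^esub> y \<alpha>"
  by (simp add: mult_E)

lemma coord_inv: "x \<in> carrier E \<Longrightarrow> \<alpha> \<in> B \<Longrightarrow> (inv\<^bsub>E\<^esub> x) \<alpha> = inv\<^bsub>Q \<alpha>\<^esub> x \<alpha>"
  by (rule group_hom.hom_inv[OF coord_hom])

lemma coord_int_pow: "x \<in> carrier E \<Longrightarrow> \<alpha> \<in> B \<Longrightarrow> (x [^]\<^bsub>E\<^esub> (n::int)) \<alpha> = x \<alpha> [^]\<^bsub>Q \<alpha>\<^esub> n"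
  by (rule group_hom.hom_int_pow[OF coord_hom])

lemma coord_nat_pow: "x \<in> carrier E \<Longrightarrow> \<alpha> \<in> B \<Longrightarrow> (x [^]\<^bsub>E\<^esub> (n::nat)) \<alpha> = x \<alpha> [^]\<^bsub>Q \<alpha>\<^esub> n"
  by (rule group_hom.hom_nat_pow[OF coord_hom])

lemma coord_b: "\<beta> \<in> B \<Longrightarrow> b \<alpha> \<beta> = (if \<beta> = \<alpha> then coord_unit (\<tau> \<alpha>) else \<one>\<^bsub>Q \<beta>\<^esub>)"
  by (simp add: coord_marker_def)

lemma coord_unit_neq_one: "\<alpha> \<in> B \<Longrightarrow> coord_unit (\<tau> \<alpha>) \<noteq> \<one>\<^bsub>Q \<alpha>\<^esub>"
  using coord_unit_pow_eq_one[of "\<tau> \<alpha>" 1] type[of \<alpha>]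
  by (auto simp: group.int_pow_1[OF Q_group coord_unit_closed])

lemma supp_b: "\<alpha> \<in> B \<Longrightarrow> supp (b \<alpha>) = {\<alpha>}"
  using coord_unit_neq_one by (auto simp: supp_def coord_b split: if_splits)

lemma b_closed: "\<alpha> \<in> B \<Longrightarrow> b \<alpha> \<in> carrier E"
proof -
  assume \<alpha>: "\<alpha> \<in> B"
  have "b \<alpha> \<in> (\<Pi>\<^sub>E \<beta>\<in>B. carrier (Q \<beta>))"
    unfolding coord_marker_def
    by (auto simp: coord_unit_closed group.subgroup_self[OF Q_group] intro!: monoid.one_closed group.is_monoid[OF Q_group])
  then show ?thesis
    using supp_b[OF \<alpha>] by (simp add: carrier_E)
qed

lemma coord_b_pow:
  "\<alpha> \<in> B \<Longrightarrow> \<beta> \<in> B \<Longrightarrow> (b \<alpha> [^]\<^bsub>E\<^esub> (n::int)) \<beta> = (if \<beta> = \<alpha> then coord_unit (\<tau> \<alpha>) [^]\<^bsub>Q \<alpha>\<^esub> n else \<one>\<^bsub>Q \<beta>\<^esub>)"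
  using group.int_pow_one[OF Q_group] by (auto simp: coord_int_pow b_closed coord_b)

lemma b_pow_eq_one:
  assumes \<alpha>: "\<alpha> \<in> B"
  shows "b \<alpha> [^]\<^bsub>E\<^esub> (n::int) = \<one>\<^bsub>E\<^esub> \<longleftrightarrow> int (\<tau> \<alpha>) dvd n"
proof -
  have "b \<alpha> [^]\<^bsub>E\<^esub> n = \<one>\<^bsub>E\<^esub> \<longleftrightarrow> coord_unit (\<tau> \<alpha>) [^]\<^bsub>Q \<alpha>\<^esub> n = \<one>\<^bsub>Q \<alpha>\<^esub>"
  proof
    assume "b \<alpha> [^]\<^bsub>E\<^esub> n = \<one>\<^bsub>E\<^esub>"
    then show "coord_unit (\<tau> \<alpha>) [^]\<^bsub>Q \<alpha>\<^esub> n = \<one>\<^bsub>Q \<alpha>\<^esub>"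
      using coord_b_pow[OF \<alpha> \<alpha>, of n] coord_one[OF \<alpha>] by simp
  next
    assume "coord_unit (\<tau> \<alpha>) [^]\<^bsub>Q \<alpha>\<^esub> n = \<one>\<^bsub>Q \<alpha>\<^esub>"
    then show "b \<alpha> [^]\<^bsub>E\<^esub> n = \<one>\<^bsub>E\<^esub>"
      using \<alpha> by (intro E_eqI) (simp_all add: b_closed coord_b_pow coord_one)
  qed
  then show ?thesis
    by (simp add: coord_unit_pow_eq_one)
qed

text \<open>All other markers lie in the kernel of the projection to coordinate \<alpha>, and a
  multiple of \<open>b \<alpha>\<close> is determined by that coordinate.\<close>

lemma b_pow_independent:
  assumes \<alpha>: "\<alpha> \<in> B" and gen: "b \<alpha> [^]\<^bsub>E\<^esub> (n::int) \<in> generate E (b ` (B - {\<alpha>}))"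
  shows "b \<alpha> [^]\<^bsub>E\<^esub> n = \<one>\<^bsub>E\<^esub>"
proof -
  interpret \<alpha>: group_hom E "Q \<alpha>" "\<lambda>x. x \<alpha>"
    by (rule coord_hom[OF \<alpha>])
  have "b ` (B - {\<alpha>}) \<subseteq> kernel E (Q \<alpha>) (\<lambda>x. x \<alpha>)"
    using \<alpha> by (auto simp: kernel_def b_closed coord_b)
  then have "generate E (b ` (B - {\<alpha>})) \<subseteq> kernel E (Q \<alpha>) (\<lambda>x. x \<alpha>)"
    by (rule E.generate_subgroup_incl) (rule \<alpha>.subgroup_kernel)
  with gen have "(b \<alpha> [^]\<^bsub>E\<^esub> n) \<alpha> = \<one>\<^bsub>Q \<alpha>\<^esub>"
    by (auto simp: kernel_def)
  then show ?thesis
    using \<alpha> by (intro E_eqI) (auto simp: b_closed coord_b_pow coord_one)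
qed

lemma divisible_E: "divisible_group E"
  unfolding divisible_group_def
proof (intro conjI allI impI ballI)
  show "comm_group E" by (rule comm_group_E)
  fix n :: nat and x assume n: "n > 0" and x: "x \<in> carrier E"
  have "\<exists>y\<in>carrier (Q \<alpha>). y [^]\<^bsub>Q \<alpha>\<^esub> n = x \<alpha>" if "\<alpha> \<in> B" for \<alpha>
    using divisible_coord_group[OF type[OF that] coord_closed[OF x that] n] by blast
  then obtain r where r: "\<And>\<alpha>. \<alpha> \<in> B \<Longrightarrow> r \<alpha> \<in> carrier (Q \<alpha>) \<and> r \<alpha> [^]\<^bsub>Q \<alpha>\<^esub> n = x \<alpha>"
    by metis
  \<comment> \<open>Roots are taken only on the support of x; a chosen root of the identity might be
    nontrivial at infinitely many coordinates.\<close>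
  define y where "y = (\<lambda>\<alpha>\<in>B. if \<alpha> \<in> supp x then r \<alpha> else \<one>\<^bsub>Q \<alpha>\<^esub>)"
  have "supp y \<subseteq> supp x"
    by (auto simp: supp_def y_def split: if_splits)
  then have "finite (supp y)"
    using x finite_subset by (auto simp: carrier_E)
  moreover have "y \<in> (\<Pi>\<^sub>E \<alpha>\<in>B. carrier (Q \<alpha>))"
    using r by (auto simp: y_def intro!: monoid.one_closed group.is_monoid[OF Q_group])
  ultimately have y: "y \<in> carrier E"
    by (simp add: carrier_E)
  have "y [^]\<^bsub>E\<^esub> n = x"
  proof (rule E_eqI)
    fix \<alpha> assume \<alpha>: "\<alpha> \<in> B"
    have "\<one>\<^bsub>Q \<alpha>\<^esub> [^]\<^bsub>Q \<alpha>\<^esub> n = \<one>\<^bsub>Q \<alpha>\<^esub>"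
      by (rule monoid.nat_pow_one[OF group.is_monoid[OF Q_group]])
    moreover have "y \<alpha> = (if x \<alpha> \<noteq> \<one>\<^bsub>Q \<alpha>\<^esub> then r \<alpha> else \<one>\<^bsub>Q \<alpha>\<^esub>)"
      using \<alpha> by (simp add: y_def supp_def)
    ultimately show "(y [^]\<^bsub>E\<^esub> n) \<alpha> = x \<alpha>"
      using r[OF \<alpha>] by (simp add: coord_nat_pow[OF y \<alpha>])
  qed (use x y in auto)
  with y show "\<exists>y\<in>carrier E. y [^]\<^bsub>E\<^esub> n = x" by blast
qed

text \<open>An element is determined by its values on its finite support, and each coordinate group
  is countable.\<close>

lemma countable_supp_fibre: "countable {x \<in> carrier E. supp x = S}"
proof (cases "finite S \<and> S \<subseteq> B")
  case True
  have "inj_on (\<lambda>x. restrict x S) {x \<in> carrier E. supp x = S}"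
  proof (rule inj_onI)
    fix x y assume x: "x \<in> {x \<in> carrier E. supp x = S}" and y: "y \<in> {x \<in> carrier E. supp x = S}"
      and eq: "restrict x S = restrict y S"
    show "x = y"
    proof (rule E_eqI)
      show "x \<alpha> = y \<alpha>" if "\<alpha> \<in> B" for \<alpha>
      proof (cases "\<alpha> \<in> S")
        case True
        then show ?thesis using fun_cong[OF eq, of \<alpha>] by simp
      next
        case False
        then show ?thesis using x y that by (auto simp: supp_def)
      qed
    qed (use x y in auto)
  qed
  moreover have "countable ((\<lambda>x. restrict x S) ` {x \<in> carrier E. supp x = S})"
  proof (rule countable_subset)
    show "(\<lambda>x. restrict x S) ` {x \<in> carrier E. supp x = S} \<subseteq> (\<Pi>\<^sub>E \<alpha>\<in>S. carrier (Q \<alpha>))"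
      using True coord_closed by (auto simp: subset_iff)
    show "countable (\<Pi>\<^sub>E \<alpha>\<in>S. carrier (Q \<alpha>))"
      using True countable_carrier_coord_group by (intro countable_PiE) auto
  qed
  ultimately show ?thesis
    by (rule countable_image_inj_on[rotated])
next
  case False
  then have "{x \<in> carrier E. supp x = S} = {}"
    by (auto simp: carrier_E supp_def)
  then show ?thesis by (simp only: countable_empty)
qed

text \<open>Induction on the finite support: subtracting a multiple of one marker removes one
  coordinate.\<close>

lemma mem_generate_b:
  assumes x: "x \<in> carrier E" and coords: "\<And>\<alpha>. \<alpha> \<in> B \<Longrightarrow> \<exists>k::int. x \<alpha> = coord_unit (\<tau> \<alpha>) [^]\<^bsub>Q \<alpha>\<^esub> k"
  shows "x \<in> generate E (b ` B)"
proof -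
  let ?M = "generate E (b ` B)"
  interpret M: subgroup ?M E
    by (rule E.generate_is_subgroup) (auto simp: b_closed)
  have "finite (supp x)"
    using x by (simp add: carrier_E)
  then show ?thesis
    using x coords
  proof (induction "supp x" arbitrary: x rule: finite_induct)
    case empty
    have "x = \<one>\<^bsub>E\<^esub>"
    proof (rule E_eqI)
      show "x \<alpha> = \<one>\<^bsub>E\<^esub> \<alpha>" if "\<alpha> \<in> B" for \<alpha>
        using empty.hyps that by (auto simp: supp_def coord_one)
    qed (use empty in auto)
    then show ?case by simp
  next
    case (insert \<alpha> F)
    have \<alpha>: "\<alpha> \<in> B"
      using insert.hyps(4) by (auto simp: supp_def)
    obtain k :: int where k: "x \<alpha> = coord_unit (\<tau> \<alpha>) [^]\<^bsub>Q \<alpha>\<^esub> k"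
      using insert.prems(2)[OF \<alpha>] by blast
    have p: "b \<alpha> [^]\<^bsub>E\<^esub> k \<in> ?M" "b \<alpha> [^]\<^bsub>E\<^esub> k \<in> carrier E"
      using E.subgroup_int_pow_closed[OF M.subgroup_axioms, of "b \<alpha>" k] \<alpha> b_closed
      by (auto intro: generate.incl)
    define y where "y = x \<otimes>\<^bsub>E\<^esub> inv\<^bsub>E\<^esub> (b \<alpha> [^]\<^bsub>E\<^esub> k)"
    have y: "y \<in> carrier E"
      using insert.prems(1) p by (simp add: y_def)
    have x_eq: "x = y \<otimes>\<^bsub>E\<^esub> (b \<alpha> [^]\<^bsub>E\<^esub> k)"
      using insert.prems(1) p by (simp add: y_def E.m_assoc)
    have y_coord: "y \<beta> = (if \<beta> = \<alpha> then \<one>\<^bsub>Q \<beta>\<^esub> else x \<beta>)" if \<beta>: "\<beta> \<in> B" for \<beta>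
    proof -
      interpret Q: group "Q \<beta>" by (rule Q_group)
      have "x \<beta> \<in> carrier (Q \<beta>)"
        by (rule coord_closed[OF insert.prems(1) \<beta>])
      then show ?thesis
        using \<alpha> \<beta> k
        by (cases "\<beta> = \<alpha>") (simp_all add: y_def coord_mult coord_inv p coord_b_pow group.r_inv[OF Q_group])
    qed
    have "\<beta> \<in> supp y \<longleftrightarrow> \<beta> \<in> supp x - {\<alpha>}" for \<beta>
      by (cases "\<beta> = \<alpha>"; cases "\<beta> \<in> B") (simp_all add: supp_def y_coord)
    then have "supp y = supp x - {\<alpha>}"
      by (simp only: set_eq_iff) simp
    then have "F = supp y"
      using insert.hyps(2) unfolding insert.hyps(4)[symmetric] by simp
    moreover have "\<exists>k::int. y \<beta> = coord_unit (\<tau> \<beta>) [^]\<^bsub>Q \<beta>\<^esub> k" if "\<beta> \<in> B" for \<beta>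
    proof (cases "\<beta> = \<alpha>")
      case True
      then show ?thesis
        using y_coord[OF that] by (intro exI[of _ 0]) simp
    next
      case False
      then show ?thesis
        using y_coord[OF that] insert.prems(2)[OF that] by simp
    qed
    ultimately have "y \<in> ?M"
      using insert.hyps(3) y by blast
    then show ?case
      using p(1) x_eq M.m_closed by metis
  qed
qed

text \<open>This gives essentiality of every subgroup containing the markers. Call a coordinate bad
  if it is no multiple of its marker. A multiple that repairs one bad coordinate while keeping it
  nonzero spoils no good one, so the finite number of bad coordinates drops.\<close>

theorem ex_pow_mem_generate_b:
  assumes "x \<in> carrier E" "x \<noteq> \<one>\<^bsub>E\<^esub>"
  shows "\<exists>n::int. x [^]\<^bsub>E\<^esub> n \<noteq> \<one>\<^bsub>E\<^esub> \<and> x [^]\<^bsub>E\<^esub> n \<in> generate E (b ` B)"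
proof -
  define bad where "bad x = {\<alpha> \<in> B. \<not> (\<exists>k::int. x \<alpha> = coord_unit (\<tau> \<alpha>) [^]\<^bsub>Q \<alpha>\<^esub> k)}" for x
  show ?thesis
    using assms
  proof (induction "card (bad x)" arbitrary: x rule: less_induct)
    case less
    note x = less.prems(1)
    show ?case
    proof (cases "bad x = {}")
      case True
      then have "x \<in> generate E (b ` B)"
        using mem_generate_b[OF x] by (auto simp: bad_def)
      then show ?thesis
        using less.prems by (intro exI[of _ 1]) simp
    next
      case False
      then obtain \<alpha> where \<alpha>: "\<alpha> \<in> bad x" by blast
      then have \<alpha>B: "\<alpha> \<in> B" by (simp add: bad_def)
      have bad_supp: "bad x \<subseteq> supp x"
      proof
        fix \<beta> assume \<beta>: "\<beta> \<in> bad x"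
        have "x \<beta> \<noteq> coord_unit (\<tau> \<beta>) [^]\<^bsub>Q \<beta>\<^esub> (0::int)"
          using \<beta> unfolding bad_def by blast
        with \<beta> show "\<beta> \<in> supp x"
          by (simp add: bad_def supp_def)
      qed
      have "x \<alpha> \<noteq> \<one>\<^bsub>Q \<alpha>\<^esub>"
        using bad_supp \<alpha> by (auto simp: supp_def)
      then obtain n k :: int where nk: "x \<alpha> [^]\<^bsub>Q \<alpha>\<^esub> n \<noteq> \<one>\<^bsub>Q \<alpha>\<^esub>"
        "x \<alpha> [^]\<^bsub>Q \<alpha>\<^esub> n = coord_unit (\<tau> \<alpha>) [^]\<^bsub>Q \<alpha>\<^esub> k"
        using coord_group_essential[OF type[OF \<alpha>B] coord_closed[OF x \<alpha>B]] by metis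
      let ?y = "x [^]\<^bsub>E\<^esub> n"
      have y: "?y \<in> carrier E" using x by simp
      have "?y \<alpha> \<noteq> \<one>\<^bsub>E\<^esub> \<alpha>"
        using nk(1) by (simp add: coord_int_pow[OF x \<alpha>B] coord_one[OF \<alpha>B])
      then have "?y \<noteq> \<one>\<^bsub>E\<^esub>" by metis
      have "bad ?y \<subseteq> bad x - {\<alpha>}"
      proof
        fix \<beta> assume \<beta>: "\<beta> \<in> bad ?y"
        then have \<beta>B: "\<beta> \<in> B" by (simp add: bad_def)
        have "\<beta> \<noteq> \<alpha>"
          using \<beta> nk(2) by (auto simp: bad_def coord_int_pow[OF x \<alpha>B])
        moreover have "\<beta> \<in> bad x"
        proof (rule ccontr)
          assume "\<beta> \<notin> bad x"
          then obtain j :: int where "x \<beta> = coord_unit (\<tau> \<beta>) [^]\<^bsub>Q \<beta>\<^esub> j"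
            using \<beta>B by (auto simp: bad_def)
          then have "?y \<beta> = coord_unit (\<tau> \<beta>) [^]\<^bsub>Q \<beta>\<^esub> (j * n)"
            by (simp add: coord_int_pow[OF x \<beta>B] group.int_pow_pow[OF Q_group coord_unit_closed])
          then show False
            using \<beta> by (auto simp: bad_def)
        qed
        ultimately show "\<beta> \<in> bad x - {\<alpha>}" by simp
      qed
      moreover have "finite (bad x)"
        using bad_supp x finite_subset by (auto simp: carrier_E)
      ultimately have "card (bad ?y) < card (bad x)"
        using \<alpha> by (intro psubset_card_mono) auto
      then obtain m :: int where "?y [^]\<^bsub>E\<^esub> m \<noteq> \<one>\<^bsub>E\<^esub>" "?y [^]\<^bsub>E\<^esub> m \<in> generate E (b ` B)"
        using less.hyps y \<open>?y \<noteq> \<one>\<^bsub>E\<^esub>\<close> by blast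
      then show ?thesis
        using x by (intro exI[of _ "n * m"]) (simp add: E.int_pow_pow)
    qed
  qed
qed

end

section \<open>Independent families and extension of homomorphisms\<close>

lemma (in group) generate_finite_subset:
  assumes "x \<in> generate G S"
  obtains F where "finite F" "F \<subseteq> S" "x \<in> generate G F"
proof -
  have "\<exists>F. finite F \<and> F \<subseteq> S \<and> x \<in> generate G F"
    using assms
  proof (induction rule: generate.induct)
    case one
    show ?case
      by (intro exI[of _ "{}"]) (simp add: generate.one)
  next
    case (incl h)
    then show ?case
      by (intro exI[of _ "{h}"]) (simp add: generate.incl)
  next
    case (inv h)
    then show ?case
      by (intro exI[of _ "{h}"]) (simp add: generate.inv)
  next
    case (eng h1 h2)
    then obtain F1 F2 where F: "finite F1" "F1 \<subseteq> S" "h1 \<in> generate G F1"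
      "finite F2" "F2 \<subseteq> S" "h2 \<in> generate G F2"
      by blast
    have "h1 \<otimes> h2 \<in> generate G (F1 \<union> F2)"
      using F mono_generate[of F1 "F1 \<union> F2"] mono_generate[of F2 "F1 \<union> F2"]
      by (intro generate.eng) auto
    with F show ?case
      by (intro exI[of _ "F1 \<union> F2"]) simp
  qed
  then show thesis using that by blast
qed

text \<open>Commutativity allows all powers of y to be collected in front.\<close>

lemma (in comm_group) generate_insert:
  assumes "y \<in> carrier G" "S \<subseteq> carrier G" "x \<in> generate G (insert y S)"
  obtains k :: int and w where "w \<in> generate G S" "x = y [^] k \<otimes> w"
proof -
  have gen: "w \<in> carrier G" if "w \<in> generate G S" for w
    using generate_in_carrier assms(2) that by blast
  have "\<exists>k::int. \<exists>w. w \<in> generate G S \<and> x = y [^] k \<otimes> w"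
    using assms(3)
  proof (induction rule: generate.induct)
    case one
    show ?case
      by (intro exI[of _ 0] exI[of _ \<one>]) (simp add: generate.one)
  next
    case (incl h)
    show ?case
    proof (cases "h = y")
      case True
      then show ?thesis
        using assms(1) by (intro exI[of _ 1] exI[of _ \<one>]) (simp add: generate.one)
    next
      case False
      then show ?thesis
        using incl assms(2) by (intro exI[of _ 0] exI[of _ h]) (auto simp: generate.incl)
    qed
  next
    case (inv h)
    show ?case
    proof (cases "h = y")
      case True
      then show ?thesis
        using assms(1) by (intro exI[of _ "-1"] exI[of _ \<one>]) (simp add: generate.one int_pow_neg)
    next
      case False
      then show ?thesis
        using inv assms(2) by (intro exI[of _ 0] exI[of _ "inv h"]) (auto simp: generate.inv)
    qed
  next
    case (eng h1 h2)
    then obtain k1 k2 :: int and w1 w2 where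
      w: "w1 \<in> generate G S" "h1 = y [^] k1 \<otimes> w1" "w2 \<in> generate G S" "h2 = y [^] k2 \<otimes> w2"
      by blast
    have "h1 \<otimes> h2 = y [^] (k1 + k2) \<otimes> (w1 \<otimes> w2)"
      using w gen assms(1) by (simp add: int_pow_mult m_ac)
    with w show ?case
      by (intro exI[of _ "k1 + k2"] exI[of _ "w1 \<otimes> w2"]) (simp add: generate.eng)
  qed
  then show thesis using that by blast
qed

text \<open>In an abelian group: the cyclic subgroups of the members form a direct sum. Torsion is
  allowed, hence the conclusion that the power is trivial rather than the exponent zero.\<close>

definition (in group) independent :: "'a set \<Rightarrow> bool" where
  "independent B \<longleftrightarrow> B \<subseteq> carrier G \<and>
    (\<forall>\<alpha>\<in>B. \<forall>n::int. \<alpha> [^] n \<in> generate G (B - {\<alpha>}) \<longrightarrow> \<alpha> [^] n = \<one>)"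

text \<open>A violation involves finitely many elements, and these lie in one member of the
  chain.\<close>

lemma (in group) independent_Union_chain:
  assumes "subset.chain \<A> \<C>" "\<And>B. B \<in> \<C> \<Longrightarrow> independent B"
  shows "independent (\<Union>\<C>)"
  unfolding independent_def
proof (intro conjI ballI allI impI)
  show "\<Union>\<C> \<subseteq> carrier G"
    using assms(2) by (auto simp: independent_def)
  fix \<alpha> and n :: int
  assume \<alpha>: "\<alpha> \<in> \<Union>\<C>" and "\<alpha> [^] n \<in> generate G (\<Union>\<C> - {\<alpha>})"
  then obtain F where F: "finite F" "F \<subseteq> \<Union>\<C> - {\<alpha>}" "\<alpha> [^] n \<in> generate G F"
    using generate_finite_subset by metis
  obtain B where B: "B \<in> \<C>" "insert \<alpha> F \<subseteq> B"
  proof (rule finite_subset_Union_chain[of "insert \<alpha> F" \<C> \<A>])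
    show "finite (insert \<alpha> F)" "insert \<alpha> F \<subseteq> \<Union>\<C>" "\<C> \<noteq> {}" "subset.chain \<A> \<C>"
      using F \<alpha> assms(1) by auto
  qed
  then have "\<alpha> [^] n \<in> generate G (B - {\<alpha>})"
    using F mono_generate[of F "B - {\<alpha>}"] by blast
  then show "\<alpha> [^] n = \<one>"
    using assms(2)[OF B(1)] B(2) unfolding independent_def by blast
qed

text \<open>A relation n \<alpha> = k y + w with w spanned by the rest puts k y in the span of B.
  Then k y = 0, and the relation lives in B.\<close>

lemma (in comm_group) independent_insert:
  assumes ind: "independent B" and y: "y \<in> carrier G" "y \<notin> B"
    and disj: "\<And>n::int. y [^] n \<in> generate G B \<Longrightarrow> y [^] n = \<one>"
  shows "independent (insert y B)"
  unfolding independent_def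
proof (intro conjI ballI allI impI)
  have B: "B \<subseteq> carrier G"
    using ind by (simp add: independent_def)
  then show "insert y B \<subseteq> carrier G"
    using y by simp
  fix \<alpha> and n :: int
  assume \<alpha>: "\<alpha> \<in> insert y B" and gen: "\<alpha> [^] n \<in> generate G (insert y B - {\<alpha>})"
  show "\<alpha> [^] n = \<one>"
  proof (cases "\<alpha> = y")
    case True
    then show ?thesis
      using gen y(2) disj by simp
  next
    case False
    then have \<alpha>B: "\<alpha> \<in> B" using \<alpha> by simp
    have BC: "B - {\<alpha>} \<subseteq> carrier G" using B by blast
    have "\<alpha> [^] n \<in> generate G (insert y (B - {\<alpha>}))"
      using gen False by (simp add: insert_Diff_if)
    then obtain k :: int and w where w: "w \<in> generate G (B - {\<alpha>})" "\<alpha> [^] n = y [^] k \<otimes> w"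
      using generate_insert[OF y(1) BC] by metis
    interpret S: subgroup "generate G B" G
      by (rule generate_is_subgroup[OF B])
    have wB: "w \<in> generate G B"
      using w(1) mono_generate[of "B - {\<alpha>}" B] by blast
    have "\<alpha> [^] n \<in> generate G B"
      using subgroup_int_pow_closed[OF S.subgroup_axioms] generate.incl[OF \<alpha>B] by blast
    moreover have "y [^] k = \<alpha> [^] n \<otimes> inv w"
      using w(2) y(1) S.mem_carrier[OF wB] by (simp add: m_assoc)
    ultimately have "y [^] k \<in> generate G B"
      using wB by simp
    then have "\<alpha> [^] n = w"
      using disj w S.mem_carrier[OF wB] by simp
    then show ?thesis
      using ind \<alpha>B w(1) unfolding independent_def by blast
  qed
qed

text \<open>As 1 is neither 0 nor prime, the power obtained is nontrivial.\<close>

lemma (in group) ex_pow_prime_or_infinite_order: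
  assumes x: "x \<in> carrier G" "x \<noteq> \<one>"
  obtains k :: nat where "ord (x [^] k) = 0 \<or> prime (ord (x [^] k))"
proof (cases "ord x = 0")
  case True
  then show thesis using that[of 1] x by simp
next
  case False
  have "ord x \<noteq> 1" using ord_eq_1 x by blast
  then obtain p where p: "prime p" "p dvd ord x"
    using prime_factor_nat by blast
  then obtain k where k: "ord x = k * p"
    by (metis dvd_def mult.commute)
  have "ord (x [^] k) = p"
    using ord_pow[of x k] x k False by simp
  then show thesis using that p by blast
qed

text \<open>If no nonzero multiple of x lay in the span of a maximal B, the same would hold for a
  multiple of x of order 0 or prime, and that multiple could be added to B.\<close>

theorem (in comm_group) ex_maximal_independent:
  obtains B where "independent B" "\<And>\<alpha>. \<alpha> \<in> B \<Longrightarrow> ord \<alpha> = 0 \<or> prime (ord \<alpha>)"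
    "\<And>x. x \<in> carrier G \<Longrightarrow> x \<noteq> \<one> \<Longrightarrow> \<exists>n::int. x [^] n \<noteq> \<one> \<and> x [^] n \<in> generate G B"
proof -
  define I where "I = {x. ord x = 0 \<or> prime (ord x)}"
  define \<A> where "\<A> = {B. B \<subseteq> I \<and> independent B}"
  have "\<exists>B\<in>\<A>. \<forall>X\<in>\<A>. B \<subseteq> X \<longrightarrow> X = B"
  proof (rule subset_Zorn')
    fix \<C> assume \<C>: "subset.chain \<A> \<C>"
    then have "\<C> \<subseteq> \<A>"
      by (simp add: subset.chain_def)
    then show "\<Union>\<C> \<in> \<A>"
      using independent_Union_chain[OF \<C>] by (auto simp: \<A>_def)
  qed
  then obtain B where B: "B \<subseteq> I" "independent B" and max: "\<And>X. X \<subseteq> I \<Longrightarrow> independent X \<Longrightarrow> B \<subseteq> X \<Longrightarrow> X = B"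
    by (auto simp: \<A>_def)
  show thesis
  proof (rule that[of B])
    show "ord \<alpha> = 0 \<or> prime (ord \<alpha>)" if "\<alpha> \<in> B" for \<alpha>
      using that B by (auto simp: I_def)
    show "\<exists>n::int. x [^] n \<noteq> \<one> \<and> x [^] n \<in> generate G B" if x: "x \<in> carrier G" "x \<noteq> \<one>" for x
    proof (rule ccontr)
      assume neg: "\<not> ?thesis"
      obtain k :: nat where k: "ord (x [^] k) = 0 \<or> prime (ord (x [^] k))"
        using ex_pow_prime_or_infinite_order x by blast
      let ?y = "x [^] k"
      have y: "?y \<in> carrier G" "?y \<in> I" using x k by (auto simp: I_def)
      have pow: "?y [^] n = x [^] (int k * n)" for n :: int
        using x by (simp add: int_pow_pow flip: int_pow_int)
      have disj: "?y [^] n = \<one>" if "?y [^] n \<in> generate G B" for n :: int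
        using neg that unfolding pow by blast
      have "ord ?y \<noteq> 1"
        using k by (auto simp: not_prime_1)
      then have "?y \<noteq> \<one>" using ord_eq_1[OF y(1)] by blast
      have "?y \<notin> B"
      proof
        assume "?y \<in> B"
        then have "?y [^] (1::int) \<in> generate G B"
          using y by (simp add: generate.incl)
        then show False
          using disj[of 1] y \<open>?y \<noteq> \<one>\<close> by simp
      qed
      then have "independent (insert ?y B)"
        using independent_insert B(2) y(1) disj by blast
      then have "insert ?y B = B"
        using max[of "insert ?y B"] y B(1) by blast
      then show False
        using \<open>?y \<notin> B\<close> by blast
    qed
  qed (rule B(2))
qed

section \<open>Extending homomorphisms into a divisible group\<close>

lemma comm_group_DirProd:
  assumes "comm_group A" "comm_group E"
  shows "comm_group (A \<times>\<times> E)"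
proof -
  interpret A: comm_group A by (rule assms)
  interpret E: comm_group E by (rule assms)
  show ?thesis
    by (rule group.group_comm_groupI[OF DirProd_group])
      (auto simp: A.group_axioms E.group_axioms A.m_comm E.m_comm)
qed

lemma int_pow_DirProd:
  assumes "group A" "group E" "x \<in> carrier A" "y \<in> carrier E"
  shows "(x, y) [^]\<^bsub>A \<times>\<times> E\<^esub> (k::int) = (x [^]\<^bsub>A\<^esub> k, y [^]\<^bsub>E\<^esub> k)"
proof -
  have g: "group (A \<times>\<times> E)"
    using assms by (simp add: DirProd_group)
  have c: "(x, y) \<in> carrier (A \<times>\<times> E)"
    using assms by simp
  have "fst \<in> hom (A \<times>\<times> E) A" "snd \<in> hom (A \<times>\<times> E) E"
    by (auto simp: hom_def)
  from hom_int_pow[OF this(1) c g assms(1), of k] hom_int_pow[OF this(2) c g assms(2), of k]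
  show ?thesis
    by (simp add: prod_eq_iff)
qed

lemma (in group) subgroup_Union_chain:
  assumes chain: "subset.chain \<A> \<C>" and ne: "\<C> \<noteq> {}" and sub: "\<And>K. K \<in> \<C> \<Longrightarrow> subgroup K G"
  shows "subgroup (\<Union>\<C>) G"
proof (rule subgroupI)
  show "\<Union>\<C> \<subseteq> carrier G"
    using sub subgroup.subset by blast
  show "\<Union>\<C> \<noteq> {}"
    using ne sub subgroup.one_closed by fastforce
  show "inv a \<in> \<Union>\<C>" if "a \<in> \<Union>\<C>" for a
    using that sub subgroup.m_inv_closed by fastforce
  show "a \<otimes> b \<in> \<Union>\<C>" if ab: "a \<in> \<Union>\<C>" "b \<in> \<Union>\<C>" for a b
  proof -
    obtain K where K: "K \<in> \<C>" "{a, b} \<subseteq> K"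
      by (rule finite_subset_Union_chain[OF _ _ ne chain, of "{a, b}"]) (use ab in auto)
    then have "a \<otimes> b \<in> K"
      using sub subgroup.m_closed by fastforce
    then show ?thesis using K by blast
  qed
qed

lemma (in group) generate_subgroup: "subgroup K G \<Longrightarrow> generate G K = K"
  using generate_subgroup_incl[of K K] generate.incl[of _ K G] by blast

text \<open>
  A homomorphism is handled as its graph, a subgroup of \<open>A \<times> E\<close>.
\<close>

lemma functional_subgroup_extend:
  assumes A: "comm_group A" and E: "divisible_group E"
    and R: "subgroup R (A \<times>\<times> E)" and fn: "\<And>e. (\<one>\<^bsub>A\<^esub>, e) \<in> R \<Longrightarrow> e = \<one>\<^bsub>E\<^esub>"
    and x: "x \<in> carrier A"
  obtains y where "y \<in> carrier E"
    "\<And>e. (\<one>\<^bsub>A\<^esub>, e) \<in> generate (A \<times>\<times> E) (insert (x, y) R) \<Longrightarrow> e = \<one>\<^bsub>E\<^esub>"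
proof -
  interpret A: comm_group A by (rule A)
  interpret E: comm_group E using E by (simp add: divisible_group_def)
  interpret P: comm_group "A \<times>\<times> E" by (rule comm_group_DirProd) unfold_locales
  interpret R: subgroup R "A \<times>\<times> E" by (rule R)
  have mem: "a \<in> carrier A" "e \<in> carrier E" if "(a, e) \<in> R" for a e
    using R.mem_carrier[OF that] by auto
  have R_mult: "(a \<otimes>\<^bsub>A\<^esub> a', e \<otimes>\<^bsub>E\<^esub> e') \<in> R" if "(a, e) \<in> R" "(a', e') \<in> R" for a e a' e'
    using R.m_closed[OF that] by simp
  have R_pow: "(a [^]\<^bsub>A\<^esub> k, e [^]\<^bsub>E\<^esub> k) \<in> R" if "(a, e) \<in> R" for a e and k :: int
    using P.subgroup_int_pow_closed[OF R that, of k] mem[OF that]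
    by (simp add: int_pow_DirProd A.is_group E.is_group)
  \<comment> \<open>The value y at x must agree with \<open>R\<close> on every multiple of x already
    in its domain.\<close>
  have "\<exists>y \<in> carrier E. \<forall>(k::int) e. (x [^]\<^bsub>A\<^esub> k, e) \<in> R \<longrightarrow> e = y [^]\<^bsub>E\<^esub> k"
  proof (cases "\<exists>k::nat. k > 0 \<and> (\<exists>e. (x [^]\<^bsub>A\<^esub> k, e) \<in> R)")
    case True
    \<comment> \<open>The multiples of x in the domain are those of the least positive one, so it
      suffices that d y is the value at d x; divisibility supplies such a y.\<close>
    define d where "d = (LEAST k::nat. k > 0 \<and> (\<exists>e. (x [^]\<^bsub>A\<^esub> k, e) \<in> R))"
    have d: "d > 0" "\<exists>e. (x [^]\<^bsub>A\<^esub> d, e) \<in> R"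
      using LeastI_ex[OF True] by (auto simp: d_def)
    then obtain e1 where e1: "(x [^]\<^bsub>A\<^esub> d, e1) \<in> R" by blast
    then have "e1 \<in> carrier E" using mem by blast
    then obtain y where y: "y \<in> carrier E" "y [^]\<^bsub>E\<^esub> d = e1"
      using E d(1) unfolding divisible_group_def by blast
    have "e = y [^]\<^bsub>E\<^esub> k" if ke: "(x [^]\<^bsub>A\<^esub> k, e) \<in> R" for k :: int and e
    proof -
      define q where "q = k div int d"
      define r where "r = nat (k mod int d)"
      have kr: "k = int d * q + int r"
        using d(1) by (simp add: q_def r_def)
      have e: "e \<in> carrier E" using mem ke by blast
      have "(x [^]\<^bsub>A\<^esub> k \<otimes>\<^bsub>A\<^esub> (x [^]\<^bsub>A\<^esub> d) [^]\<^bsub>A\<^esub> (- q), e \<otimes>\<^bsub>E\<^esub> e1 [^]\<^bsub>E\<^esub> (- q)) \<in> R"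
        by (rule R_mult[OF ke R_pow[OF e1]])
      moreover have "x [^]\<^bsub>A\<^esub> k \<otimes>\<^bsub>A\<^esub> (x [^]\<^bsub>A\<^esub> d) [^]\<^bsub>A\<^esub> (- q) = x [^]\<^bsub>A\<^esub> r"
        using x by (simp add: kr A.int_pow_pow flip: int_pow_int A.int_pow_mult)
      ultimately have rR: "(x [^]\<^bsub>A\<^esub> r, e \<otimes>\<^bsub>E\<^esub> e1 [^]\<^bsub>E\<^esub> (- q)) \<in> R"
        by simp
      have "r < d"
        using d(1) by (simp add: r_def nat_less_iff)
      then have "\<not> (r > 0 \<and> (\<exists>e. (x [^]\<^bsub>A\<^esub> r, e) \<in> R))"
        unfolding d_def by (rule not_less_Least)
      then have "r = 0"
        using rR unfolding neq0_conv[symmetric] by blast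
      then have "(\<one>\<^bsub>A\<^esub>, e \<otimes>\<^bsub>E\<^esub> e1 [^]\<^bsub>E\<^esub> (- q)) \<in> R"
        using rR by simp
      then have "e \<otimes>\<^bsub>E\<^esub> e1 [^]\<^bsub>E\<^esub> (- q) = \<one>\<^bsub>E\<^esub>"
        by (rule fn)
      then have "e = e1 [^]\<^bsub>E\<^esub> q"
        using e \<open>e1 \<in> carrier E\<close> by (simp add: E.int_pow_neg E.inv_solve_right')
      also have "\<dots> = y [^]\<^bsub>E\<^esub> k"
        unfolding y(2)[symmetric]
        using y(1) \<open>r = 0\<close> by (simp add: kr E.int_pow_pow flip: int_pow_int)
      finally show ?thesis .
    qed
    then show ?thesis
      by (intro bexI[of _ y] allI impI y(1))
  next
    case False
    have "e = \<one>\<^bsub>E\<^esub> [^]\<^bsub>E\<^esub> k" if ke: "(x [^]\<^bsub>A\<^esub> k, e) \<in> R" for k :: int and e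
    proof -
      \<comment> \<open>No positive multiple of x is in the domain; \<open>sgn k\<close> turns a
        negative one into a positive one.\<close>
      have "(x [^]\<^bsub>A\<^esub> (\<bar>k\<bar>), e [^]\<^bsub>E\<^esub> (sgn k)) \<in> R"
        using R_pow[OF ke, of "sgn k"] by (simp only: A.int_pow_pow[OF x] abs_sgn[symmetric])
      then have "(x [^]\<^bsub>A\<^esub> (nat \<bar>k\<bar>), e [^]\<^bsub>E\<^esub> (sgn k)) \<in> R"
        by (simp flip: int_pow_int)
      then have ex: "\<exists>e. (x [^]\<^bsub>A\<^esub> (nat \<bar>k\<bar>), e) \<in> R"
        by (rule exI)
      have "\<not> 0 < nat \<bar>k\<bar>"
        by (rule contrapos_nn[OF False]) (rule exI[of _ "nat \<bar>k\<bar>"], rule conjI[OF _ ex])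
      then have "k = 0"
        by simp
      then have "(\<one>\<^bsub>A\<^esub>, e) \<in> R"
        using ke by simp
      then have "e = \<one>\<^bsub>E\<^esub>"
        by (rule fn)
      then show ?thesis
        using \<open>k = 0\<close> by simp
    qed
    then show ?thesis
      by (intro bexI[of _ "\<one>\<^bsub>E\<^esub>"] allI impI E.one_closed)
  qed
  then obtain y where y: "y \<in> carrier E" "\<And>(k::int) e. (x [^]\<^bsub>A\<^esub> k, e) \<in> R \<Longrightarrow> e = y [^]\<^bsub>E\<^esub> k"
    by blast
  have "e = \<one>\<^bsub>E\<^esub>" if gen: "(\<one>\<^bsub>A\<^esub>, e) \<in> generate (A \<times>\<times> E) (insert (x, y) R)" for e
  proof -
    obtain k :: int and w where w: "w \<in> generate (A \<times>\<times> E) R" "(\<one>\<^bsub>A\<^esub>, e) = (x, y) [^]\<^bsub>A \<times>\<times> E\<^esub> k \<otimes>\<^bsub>A \<times>\<times> E\<^esub> w"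
      by (rule P.generate_insert[OF _ R.subset gen]) (use x y(1) in simp)
    obtain a e' where "w = (a, e')"
      by (rule prod.exhaust)
    with w(1) have w': "w = (a, e')" "(a, e') \<in> R"
      by (simp_all add: P.generate_subgroup[OF R])
    note c = mem[OF w'(2)]
    have eq: "\<one>\<^bsub>A\<^esub> = x [^]\<^bsub>A\<^esub> k \<otimes>\<^bsub>A\<^esub> a" "e = y [^]\<^bsub>E\<^esub> k \<otimes>\<^bsub>E\<^esub> e'"
      using w(2) w'(1) x y(1) by (simp_all add: int_pow_DirProd A.is_group E.is_group)
    have "a = x [^]\<^bsub>A\<^esub> (- k)"
      using A.inv_equality[of a "x [^]\<^bsub>A\<^esub> k"] A.inv_equality[of "x [^]\<^bsub>A\<^esub> k" a] eq(1) x c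
      by (simp add: A.int_pow_neg A.m_comm)
    then have "e' = y [^]\<^bsub>E\<^esub> (- k)"
      using w'(2) by (intro y(2)) simp
    then show ?thesis
      using eq(2) y(1) by (simp add: E.int_pow_neg)
  qed
  with y(1) show thesis using that by blast
qed

text \<open>Divisible abelian groups are injective, by Zorn's lemma: \<open>T\<close> is the graph
  of a homomorphism on a subgroup, and a maximal graph above it is total by
  \<open>functional_subgroup_extend\<close>.\<close>

theorem extend_functional_subgroup:
  assumes A: "comm_group A" and E: "divisible_group E"
    and T: "subgroup T (A \<times>\<times> E)" and fn: "\<And>e. (\<one>\<^bsub>A\<^esub>, e) \<in> T \<Longrightarrow> e = \<one>\<^bsub>E\<^esub>"
  obtains h where "h \<in> hom A E" "\<And>a e. (a, e) \<in> T \<Longrightarrow> h a = e"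
proof -
  interpret A: comm_group A by (rule A)
  interpret E: comm_group E using E by (simp add: divisible_group_def)
  interpret P: comm_group "A \<times>\<times> E" by (rule comm_group_DirProd) unfold_locales
  define \<A> where "\<A> = {R. subgroup R (A \<times>\<times> E) \<and> T \<subseteq> R \<and> (\<forall>e. (\<one>\<^bsub>A\<^esub>, e) \<in> R \<longrightarrow> e = \<one>\<^bsub>E\<^esub>)}"
  have "\<exists>R\<in>\<A>. \<forall>X\<in>\<A>. R \<subseteq> X \<longrightarrow> X = R"
  proof (rule subset_Zorn_nonempty)
    show "\<A> \<noteq> {}"
      using T fn unfolding \<A>_def by blast
    fix \<C> assume \<C>: "\<C> \<noteq> {}" "subset.chain \<A> \<C>"
    then have sub: "\<C> \<subseteq> \<A>"
      by (simp add: subset.chain_def)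
    have "subgroup (\<Union>\<C>) (A \<times>\<times> E)"
      by (rule P.subgroup_Union_chain[OF \<C>(2,1)]) (use sub in \<open>auto simp: \<A>_def\<close>)
    moreover have "T \<subseteq> \<Union>\<C>"
      using sub \<C>(1) unfolding \<A>_def by blast
    moreover have "e = \<one>\<^bsub>E\<^esub>" if "(\<one>\<^bsub>A\<^esub>, e) \<in> \<Union>\<C>" for e
      using sub that unfolding \<A>_def by blast
    ultimately show "\<Union>\<C> \<in> \<A>"
      unfolding \<A>_def by blast
  qed
  then obtain R where "R \<in> \<A>" and max: "\<And>X. X \<in> \<A> \<Longrightarrow> R \<subseteq> X \<Longrightarrow> X = R"
    by blast
  then have R: "subgroup R (A \<times>\<times> E)" "T \<subseteq> R" "\<And>e. (\<one>\<^bsub>A\<^esub>, e) \<in> R \<Longrightarrow> e = \<one>\<^bsub>E\<^esub>"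
    unfolding \<A>_def by blast+
  interpret R: subgroup R "A \<times>\<times> E" by (rule R)
  have mem: "a \<in> carrier A" "e \<in> carrier E" if "(a, e) \<in> R" for a e
    using R.mem_carrier[OF that] by auto
  have R_mult: "(a \<otimes>\<^bsub>A\<^esub> a', e \<otimes>\<^bsub>E\<^esub> e') \<in> R" if "(a, e) \<in> R" "(a', e') \<in> R" for a e a' e'
    using R.m_closed[OF that] by simp
  \<comment> \<open>For a subgroup, a trivial fibre over the identity makes all fibres
    singletons.\<close>
  have unique: "e = e'" if "(a, e) \<in> R" "(a, e') \<in> R" for a e e'
  proof -
    note c = mem[OF that(1)] mem[OF that(2)]
    have "inv\<^bsub>A \<times>\<times> E\<^esub> (a, e') \<in> R"
      using that(2) by (rule R.m_inv_closed)
    then have "(inv\<^bsub>A\<^esub> a, inv\<^bsub>E\<^esub> e') \<in> R"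
      using c by (simp add: A.is_group E.is_group)
    from R_mult[OF that(1) this] have "e \<otimes>\<^bsub>E\<^esub> inv\<^bsub>E\<^esub> e' = \<one>\<^bsub>E\<^esub>"
      using c by (intro R(3)) simp
    then show ?thesis
      using c by (simp add: E.inv_solve_right')
  qed
  have total: "\<exists>e. (x, e) \<in> R" if x: "x \<in> carrier A" for x
  proof -
    obtain y where y: "y \<in> carrier E"
      "\<And>e. (\<one>\<^bsub>A\<^esub>, e) \<in> generate (A \<times>\<times> E) (insert (x, y) R) \<Longrightarrow> e = \<one>\<^bsub>E\<^esub>"
      using functional_subgroup_extend[OF A E R(1) R(3) x] by blast
    let ?R' = "generate (A \<times>\<times> E) (insert (x, y) R)"
    have sub: "insert (x, y) R \<subseteq> ?R'"
      by (auto intro: generate.incl)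
    have "subgroup ?R' (A \<times>\<times> E)"
      using x y(1) R.subset by (intro P.generate_is_subgroup) auto
    then have "?R' \<in> \<A>"
      using y(2) sub R(2) unfolding \<A>_def by blast
    then have "?R' = R"
      using max sub by blast
    then show ?thesis
      using sub by blast
  qed
  define h where "h a = (THE e. (a, e) \<in> R)" for a
  have h: "h a = e" if "(a, e) \<in> R" for a e
    unfolding h_def by (rule the_equality[where P = "\<lambda>e. (a, e) \<in> R", OF that unique[OF _ that]])
  have hR: "(a, h a) \<in> R" if "a \<in> carrier A" for a
    using total[OF that] h by metis
  have "h \<in> hom A E"
  proof (rule homI)
    show "h a \<in> carrier E" if "a \<in> carrier A" for a
      using mem(2)[OF hR[OF that]] .
    show "h (a \<otimes>\<^bsub>A\<^esub> b) = h a \<otimes>\<^bsub>E\<^esub> h b" if "a \<in> carrier A" "b \<in> carrier A" for a b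
      by (rule h[OF R_mult[OF hR[OF that(1)] hR[OF that(2)]]])
  qed
  with h R(2) show thesis
    using that by blast
qed

text \<open>By independence on both sides, \<open>\<alpha> \<mapsto> m \<alpha>\<close> generates the graph of an isomorphism.\<close>

lemma generate_pairs_one_iff:
  assumes A: "comm_group A" and E: "comm_group E"
    and ind: "group.independent A B" and m: "m ` B \<subseteq> carrier E"
    and m_ind: "\<And>\<alpha> (n::int). \<alpha> \<in> B \<Longrightarrow> m \<alpha> [^]\<^bsub>E\<^esub> n \<in> generate E (m ` (B - {\<alpha>})) \<Longrightarrow> m \<alpha> [^]\<^bsub>E\<^esub> n = \<one>\<^bsub>E\<^esub>"
    and ord: "\<And>\<alpha> (n::int). \<alpha> \<in> B \<Longrightarrow> m \<alpha> [^]\<^bsub>E\<^esub> n = \<one>\<^bsub>E\<^esub> \<longleftrightarrow> \<alpha> [^]\<^bsub>A\<^esub> n = \<one>\<^bsub>A\<^esub>"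
    and mem: "(a, e) \<in> generate (A \<times>\<times> E) ((\<lambda>\<alpha>. (\<alpha>, m \<alpha>)) ` B)"
  shows "a = \<one>\<^bsub>A\<^esub> \<longleftrightarrow> e = \<one>\<^bsub>E\<^esub>"
proof -
  interpret A: comm_group A by (rule A)
  interpret E: comm_group E by (rule E)
  interpret P: comm_group "A \<times>\<times> E" by (rule comm_group_DirProd) unfold_locales
  let ?p = "\<lambda>\<alpha>. (\<alpha>, m \<alpha>)"
  have BC: "B \<subseteq> carrier A"
    using ind by (simp add: A.independent_def)
  have pC: "?p ` F \<subseteq> carrier (A \<times>\<times> E)" if "F \<subseteq> B" for F
    using that BC m by auto
  have proj: "a \<in> generate A F \<and> e \<in> generate E (m ` F)"
    if F: "F \<subseteq> B" and ae: "(a, e) \<in> generate (A \<times>\<times> E) (?p ` F)" for F a e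
  proof -
    interpret f: group_hom "A \<times>\<times> E" A fst
      by unfold_locales (auto simp: hom_def)
    interpret s: group_hom "A \<times>\<times> E" E snd
      by unfold_locales (auto simp: hom_def)
    have "fst ` ?p ` F = F" "snd ` ?p ` F = m ` F"
      by (simp_all add: image_image)
    then show ?thesis
      using imageI[OF ae, of fst] imageI[OF ae, of snd]
        f.generate_img[OF pC[OF F]] s.generate_img[OF pC[OF F]] by simp
  qed
  have *: "a = \<one>\<^bsub>A\<^esub> \<longleftrightarrow> e = \<one>\<^bsub>E\<^esub>"
    if "finite F" "F \<subseteq> B" "(a, e) \<in> generate (A \<times>\<times> E) (?p ` F)" for F a e
    using that
  proof (induction F arbitrary: a e rule: finite_induct)
    case empty
    then have "(a, e) \<in> {\<one>\<^bsub>A \<times>\<times> E\<^esub>}"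
      using P.generate_empty by simp
    then show ?case by simp
  next
    case (insert \<alpha> F)
    have \<alpha>: "\<alpha> \<in> B" "\<alpha> \<in> carrier A" "m \<alpha> \<in> carrier E" and F: "F \<subseteq> B - {\<alpha>}"
      using insert BC m by auto
    have gen: "(a, e) \<in> generate (A \<times>\<times> E) (insert (\<alpha>, m \<alpha>) (?p ` F))"
      using insert.prems by simp
    obtain k :: int and w where w: "w \<in> generate (A \<times>\<times> E) (?p ` F)"
      "(a, e) = (\<alpha>, m \<alpha>) [^]\<^bsub>A \<times>\<times> E\<^esub> k \<otimes>\<^bsub>A \<times>\<times> E\<^esub> w"
      by (rule P.generate_insert[OF _ pC gen]) (use \<alpha> F in auto)
    obtain a' e' where "w = (a', e')"
      by (rule prod.exhaust)
    with w(1) have w': "w = (a', e')" "(a', e') \<in> generate (A \<times>\<times> E) (?p ` F)"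
      by simp_all
    have eq: "a = \<alpha> [^]\<^bsub>A\<^esub> k \<otimes>\<^bsub>A\<^esub> a'" "e = m \<alpha> [^]\<^bsub>E\<^esub> k \<otimes>\<^bsub>E\<^esub> e'"
      using w(2) w'(1) \<alpha> by (simp_all add: int_pow_DirProd A.is_group E.is_group)
    have gen: "a' \<in> generate A F" "e' \<in> generate E (m ` F)"
      using proj[OF _ w'(2)] F by auto
    have FC: "F \<subseteq> carrier A" "m ` F \<subseteq> carrier E"
      using F BC m by auto
    have c: "a' \<in> carrier A" "e' \<in> carrier E"
      using A.generate_in_carrier[OF FC(1) gen(1)] E.generate_in_carrier[OF FC(2) gen(2)] by auto
    have IH: "a' = \<one>\<^bsub>A\<^esub> \<longleftrightarrow> e' = \<one>\<^bsub>E\<^esub>"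
      using insert.IH[OF _ w'(2)] F by blast
    \<comment> \<open>A vanishing sum puts the multiple of \<alpha> in the span of the other
      elements, so independence kills both summands; \<open>ord\<close> and the induction hypothesis
      carry this over to the other side.\<close>
    have a_one: "\<alpha> [^]\<^bsub>A\<^esub> k = \<one>\<^bsub>A\<^esub>" if "a = \<one>\<^bsub>A\<^esub>"
    proof -
      have "\<alpha> [^]\<^bsub>A\<^esub> k = inv\<^bsub>A\<^esub> a'"
        using A.inv_equality[of "\<alpha> [^]\<^bsub>A\<^esub> k" a'] eq(1) that c \<alpha> by simp
      then have "\<alpha> [^]\<^bsub>A\<^esub> k \<in> generate A F"
        using A.generate_m_inv_closed[OF FC(1) gen(1)] by simp
      then have "\<alpha> [^]\<^bsub>A\<^esub> k \<in> generate A (B - {\<alpha>})"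
        using A.mono_generate[OF F] by (rule rev_subsetD)
      then show ?thesis
        using ind \<alpha>(1) by (simp add: A.independent_def)
    qed
    have e_one: "m \<alpha> [^]\<^bsub>E\<^esub> k = \<one>\<^bsub>E\<^esub>" if "e = \<one>\<^bsub>E\<^esub>"
    proof -
      have "m \<alpha> [^]\<^bsub>E\<^esub> k = inv\<^bsub>E\<^esub> e'"
        using E.inv_equality[of "m \<alpha> [^]\<^bsub>E\<^esub> k" e'] eq(2) that c \<alpha> by simp
      then have "m \<alpha> [^]\<^bsub>E\<^esub> k \<in> generate E (m ` F)"
        using E.generate_m_inv_closed[OF FC(2) gen(2)] by simp
      then have "m \<alpha> [^]\<^bsub>E\<^esub> k \<in> generate E (m ` (B - {\<alpha>}))"
        using E.mono_generate[OF image_mono[OF F]] by (rule rev_subsetD)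
      with \<alpha>(1) show ?thesis
        by (rule m_ind)
    qed
    show ?case
    proof
      assume "a = \<one>\<^bsub>A\<^esub>"
      with a_one have "\<alpha> [^]\<^bsub>A\<^esub> k = \<one>\<^bsub>A\<^esub>" "a' = \<one>\<^bsub>A\<^esub>"
        using eq(1) c by simp_all
      then show "e = \<one>\<^bsub>E\<^esub>"
        using ord[OF \<alpha>(1), of k] IH eq(2) by simp
    next
      assume "e = \<one>\<^bsub>E\<^esub>"
      with e_one have "m \<alpha> [^]\<^bsub>E\<^esub> k = \<one>\<^bsub>E\<^esub>" "e' = \<one>\<^bsub>E\<^esub>"
        using eq(2) c by simp_all
      then show "a = \<one>\<^bsub>A\<^esub>"
        using ord[OF \<alpha>(1), of k] IH eq(1) by simp
    qed
  qed
  obtain F where F: "finite F" "F \<subseteq> ?p ` B" "(a, e) \<in> generate (A \<times>\<times> E) F"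
    by (rule P.generate_finite_subset[OF mem])
  then obtain F' where F': "F' \<subseteq> B" "finite F'" "F = ?p ` F'"
    using finite_subset_image[OF F(1,2)] by blast
  show ?thesis
    by (rule *[OF F'(2,1)]) (use F(3) F'(3) in simp)
qed

text \<open>On the span of B, \<open>one_iff\<close> gives well-definedness in one direction and
  injectivity in the other. A nonzero x in the kernel would have a nonzero multiple in that span,
  still in the kernel.\<close>

theorem ex_mono_extending_independent:
  assumes A: "comm_group A" and E: "divisible_group E"
    and ind: "group.independent A B" and m: "m ` B \<subseteq> carrier E"
    and m_ind: "\<And>\<alpha> (n::int). \<alpha> \<in> B \<Longrightarrow> m \<alpha> [^]\<^bsub>E\<^esub> n \<in> generate E (m ` (B - {\<alpha>})) \<Longrightarrow> m \<alpha> [^]\<^bsub>E\<^esub> n = \<one>\<^bsub>E\<^esub>"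
    and ord: "\<And>\<alpha> (n::int). \<alpha> \<in> B \<Longrightarrow> m \<alpha> [^]\<^bsub>E\<^esub> n = \<one>\<^bsub>E\<^esub> \<longleftrightarrow> \<alpha> [^]\<^bsub>A\<^esub> n = \<one>\<^bsub>A\<^esub>"
    and ess: "\<And>x. x \<in> carrier A \<Longrightarrow> x \<noteq> \<one>\<^bsub>A\<^esub> \<Longrightarrow> \<exists>n::int. x [^]\<^bsub>A\<^esub> n \<noteq> \<one>\<^bsub>A\<^esub> \<and> x [^]\<^bsub>A\<^esub> n \<in> generate A B"
  obtains \<iota> where "\<iota> \<in> mon A E" "\<And>\<alpha>. \<alpha> \<in> B \<Longrightarrow> \<iota> \<alpha> = m \<alpha>"
proof -
  interpret A: comm_group A by (rule A)
  interpret E: comm_group E using E by (simp add: divisible_group_def)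
  interpret P: comm_group "A \<times>\<times> E" by (rule comm_group_DirProd) unfold_locales
  have BC: "B \<subseteq> carrier A"
    using ind by (simp add: A.independent_def)
  define T where "T = generate (A \<times>\<times> E) ((\<lambda>\<alpha>. (\<alpha>, m \<alpha>)) ` B)"
  have pC: "(\<lambda>\<alpha>. (\<alpha>, m \<alpha>)) ` B \<subseteq> carrier (A \<times>\<times> E)"
    using BC m by auto
  have T: "subgroup T (A \<times>\<times> E)"
    unfolding T_def by (rule P.generate_is_subgroup[OF pC])
  have one_iff: "a = \<one>\<^bsub>A\<^esub> \<longleftrightarrow> e = \<one>\<^bsub>E\<^esub>" if "(a, e) \<in> T" for a e
    using generate_pairs_one_iff[OF A E.comm_group_axioms ind m m_ind ord] that unfolding T_def by blast
  have "e = \<one>\<^bsub>E\<^esub>" if "(\<one>\<^bsub>A\<^esub>, e) \<in> T" for e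
    using one_iff[OF that] by simp
  then obtain h where h: "h \<in> hom A E" "\<And>a e. (a, e) \<in> T \<Longrightarrow> h a = e"
    using extend_functional_subgroup[OF A E T] by blast
  interpret h: group_hom A E h
    by unfold_locales (rule h)
  have "inj_on h (carrier A)"
    unfolding h.inj_on_one_iff
  proof (intro allI impI)
    fix x assume x: "x \<in> carrier A" "h x = \<one>\<^bsub>E\<^esub>"
    show "x = \<one>\<^bsub>A\<^esub>"
    proof (rule ccontr)
      assume "x \<noteq> \<one>\<^bsub>A\<^esub>"
      then obtain n :: int where n: "x [^]\<^bsub>A\<^esub> n \<noteq> \<one>\<^bsub>A\<^esub>" "x [^]\<^bsub>A\<^esub> n \<in> generate A B"
        using ess x by blast
      interpret f: group_hom "A \<times>\<times> E" A fst
        by unfold_locales (auto simp: hom_def)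
      have "generate A B = fst ` T"
        using f.generate_img[OF pC] by (simp add: T_def image_image)
      then obtain e where e: "(x [^]\<^bsub>A\<^esub> n, e) \<in> T"
        using n(2) by force
      have "e = h (x [^]\<^bsub>A\<^esub> n)"
        using h(2)[OF e] by simp
      also have "\<dots> = \<one>\<^bsub>E\<^esub>"
        using x by (simp add: h.hom_int_pow)
      finally show False
        using one_iff[OF e] n(1) by blast
    qed
  qed
  then have "h \<in> mon A E"
    using h(1) by (simp add: mon_def)
  moreover have "h \<alpha> = m \<alpha>" if "\<alpha> \<in> B" for \<alpha>
    using that by (intro h(2)) (auto simp: T_def intro: generate.incl)
  ultimately show thesis using that by blast
qed

section \<open>The theorem\<close>

theorem theoremA1:
  fixes A :: "('a, 'b) monoid_scheme"
  assumes "comm_group A"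
  shows "\<exists>(\<kappa> :: 'a rel) (\<tau> :: 'a \<Rightarrow> nat)
            (\<iota> :: 'a \<Rightarrow> 'a \<Rightarrow> rat set) (d :: ('a \<Rightarrow> rat set) \<Rightarrow> ('a \<Rightarrow> rat set) \<Rightarrow> real).
    Well_order \<kappa> \<and> (\<forall>\<alpha> \<in> Field \<kappa>. \<tau> \<alpha> = 0 \<or> prime (\<tau> \<alpha>)) \<and>
    (let E = coord_sum \<kappa> \<tau>;
         b = coord_marker \<kappa> \<tau>;
         A' = \<iota> ` carrier A;
         M = generate E (b ` Field \<kappa>)
     in divisible_group E \<and>
        \<iota> \<in> mon A E \<and> essential_in A' E \<and>
        (\<forall>\<alpha> \<in> Field \<kappa>. b \<alpha> \<in> A') \<and>
        Metric_space (carrier E) d \<and> translation_invariant E d \<and>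
        (\<lambda>(x, y). d x y) ` (carrier E \<times> carrier E)
          \<subseteq> {0} \<union> {1 + 2 powi (- n) | n :: int. n \<ge> 1} \<and>
        (\<forall>H. subgroup H E \<and> M \<subseteq> H \<longrightarrow> affinely_rigid E d H) \<and>
        affinely_rigid E d A' \<and> affinely_rigid E d (carrier E))"
proof -
  interpret A: comm_group A by (rule assms)
  obtain B where ind: "A.independent B" and ord_B: "\<And>\<alpha>. \<alpha> \<in> B \<Longrightarrow> A.ord \<alpha> = 0 \<or> prime (A.ord \<alpha>)"
    and ess_B: "\<And>x. x \<in> carrier A \<Longrightarrow> x \<noteq> \<one>\<^bsub>A\<^esub> \<Longrightarrow>
      \<exists>n::int. x [^]\<^bsub>A\<^esub> n \<noteq> \<one>\<^bsub>A\<^esub> \<and> x [^]\<^bsub>A\<^esub> n \<in> generate A B"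
    using A.ex_maximal_independent by blast
  have B_carrier: "B \<subseteq> carrier A"
    using ind by (simp add: A.independent_def)
  obtain \<kappa> where "well_order_on B \<kappa>"
    using well_order_on by blast
  then have Field: "Field \<kappa> = B" and wo: "Well_order \<kappa>"
    using well_order_on_Field by (blast, metis)
  \<comment> \<open>The elements of \<open>B\<close> themselves serve as indices, and each one's
    order is its type, so marker and element have equal orders.\<close>
  define \<tau> where "\<tau> = A.ord"
  interpret coordinate_sum \<kappa> \<tau>
    by unfold_locales (use ord_B Field in \<open>simp add: \<tau>_def\<close>)
  obtain g :: "'a set \<Rightarrow> nat" where g: "\<And>\<phi>. bij_betw \<phi> (Field \<kappa>) (Field \<kappa>) \<Longrightarrow>
      (\<forall>\<alpha>\<in>Field \<kappa>. \<forall>\<beta>\<in>Field \<kappa>. g {\<phi> \<alpha>, \<phi> \<beta>} = g {\<alpha>, \<beta>}) \<Longrightarrow> \<forall>\<alpha>\<in>Field \<kappa>. \<phi> \<alpha> = \<alpha>"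
    using ex_rigid_pair_colouring[of "Field \<kappa>"] by blast
  interpret M: marked_group "coord_sum \<kappa> \<tau>" "Field \<kappa>" supp "coord_marker \<kappa> \<tau>" g
  proof (intro marked_group.intro comm_group_E marked_group_axioms.intro)
    fix x y assume x: "x \<in> carrier E"
    show "supp x \<subseteq> Field \<kappa>"
      by (auto simp: supp_def)
    show "finite (supp x)"
      using x by (simp add: carrier_E)
    show "supp (inv\<^bsub>E\<^esub> x) = supp x"
    proof -
      have "(inv\<^bsub>E\<^esub> x) \<alpha> = \<one>\<^bsub>Q \<alpha>\<^esub> \<longleftrightarrow> x \<alpha> = \<one>\<^bsub>Q \<alpha>\<^esub>" if "\<alpha> \<in> Field \<kappa>" for \<alpha>
        using group.inv_eq_1_iff[OF Q_group coord_closed[OF x that]] by (simp add: coord_inv[OF x that])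
      then show ?thesis
        unfolding supp_def by blast
    qed
    show "supp (x \<otimes>\<^bsub>E\<^esub> y) \<subseteq> supp x \<union> supp y"
      using monoid.l_one[OF group.is_monoid[OF Q_group] monoid.one_closed[OF group.is_monoid[OF Q_group]]]
      by (fastforce simp: supp_def coord_mult)
  next
    show "\<phi> \<alpha> = \<alpha>" if "bij_betw \<phi> (Field \<kappa>) (Field \<kappa>)"
      "\<forall>\<alpha>\<in>Field \<kappa>. \<forall>\<beta>\<in>Field \<kappa>. g {\<phi> \<alpha>, \<phi> \<beta>} = g {\<alpha>, \<beta>}" "\<alpha> \<in> Field \<kappa>" for \<phi> \<alpha>
      using g[OF that(1,2)] that(3) by blast
  qed (simp_all add: countable_supp_fibre b_closed supp_b)
  obtain \<iota> where \<iota>: "\<iota> \<in> mon A E" and \<iota>_B: "\<And>\<alpha>. \<alpha> \<in> B \<Longrightarrow> \<iota> \<alpha> = b \<alpha>"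
  proof (rule ex_mono_extending_independent[OF assms divisible_E ind])
    show "b ` B \<subseteq> carrier E"
      using b_closed Field by auto
    show "b \<alpha> [^]\<^bsub>E\<^esub> n = \<one>\<^bsub>E\<^esub>" if "\<alpha> \<in> B" "b \<alpha> [^]\<^bsub>E\<^esub> n \<in> generate E (b ` (B - {\<alpha>}))" for \<alpha> and n :: int
      using b_pow_independent[of \<alpha> n] that Field by simp
    show "b \<alpha> [^]\<^bsub>E\<^esub> n = \<one>\<^bsub>E\<^esub> \<longleftrightarrow> \<alpha> [^]\<^bsub>A\<^esub> n = \<one>\<^bsub>A\<^esub>" if "\<alpha> \<in> B" for \<alpha> and n :: int
    proof -
      have "\<alpha> \<in> Field \<kappa>" "\<alpha> \<in> carrier A"
        using that B_carrier Field by auto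
      then show ?thesis
        using b_pow_eq_one[of \<alpha> n] A.int_pow_eq_id[of \<alpha> n] by (simp only: \<tau>_def)
    qed
  qed (use ess_B in auto)
  let ?A' = "\<iota> ` carrier A"
  interpret \<iota>: group_hom A E \<iota>
    using \<iota> by unfold_locales (simp add: mon_def)
  have A': "subgroup ?A' E"
    by (rule \<iota>.img_is_subgroup)
  have b_A': "b \<alpha> \<in> ?A'" if "\<alpha> \<in> Field \<kappa>" for \<alpha>
    using that \<iota>_B[of \<alpha>] B_carrier Field by (metis imageI subsetD)
  have M_A': "generate E (b ` Field \<kappa>) \<subseteq> ?A'"
    using b_A' by (intro E.generate_subgroup_incl A') auto
  have "essential_in ?A' E"
    unfolding essential_in_def
  proof (intro allI impI)
    fix K assume K: "subgroup K E \<and> K \<noteq> {\<one>\<^bsub>E\<^esub>}"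
    then have "\<one>\<^bsub>E\<^esub> \<in> K"
      by (simp add: subgroup.one_closed)
    with K obtain x where x: "x \<in> K" "x \<noteq> \<one>\<^bsub>E\<^esub>"
      by blast
    then have "x \<in> carrier E"
      using K subgroup.mem_carrier by metis
    then obtain n :: int where n: "x [^]\<^bsub>E\<^esub> n \<noteq> \<one>\<^bsub>E\<^esub>" "x [^]\<^bsub>E\<^esub> n \<in> generate E (b ` Field \<kappa>)"
      using ex_pow_mem_generate_b x(2) by blast
    have "x [^]\<^bsub>E\<^esub> n \<in> K"
      using K x(1) by (intro E.subgroup_int_pow_closed) auto
    with n M_A' show "K \<inter> ?A' \<noteq> {\<one>\<^bsub>E\<^esub>}"
      by blast
  qed
  moreover have "affinely_rigid E M.cdist H" if "subgroup H E" "generate E (b ` Field \<kappa>) \<subseteq> H" for H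
  proof (rule M.affinely_rigid_cdist[OF that(1)])
    show "b ` Field \<kappa> \<subseteq> H"
      using that(2) generate.incl[of _ "b ` Field \<kappa>" E] by blast
  qed
  moreover have "generate E (b ` Field \<kappa>) \<subseteq> carrier E"
    using b_closed by (intro E.generate_incl) auto
  moreover have "(\<lambda>(x, y). M.cdist x y) ` (carrier E \<times> carrier E)
      \<subseteq> {0} \<union> {1 + 2 powi (- n) | n :: int. n \<ge> 1}"
    using M.cdist_range by auto
  ultimately show ?thesis
    using wo type divisible_E \<iota> b_A' M.Metric_space_cdist[OF order_refl] M.translation_invariant_cdist
      A' M_A' E.subgroup_self
    unfolding Let_def
    by (intro exI[of _ \<kappa>] exI[of _ \<tau>] exI[of _ \<iota>] exI[of _ M.cdist] conjI ballI) simp_all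
qed

end
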